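(* Let $u\in H^1(0,1)$, $c\in\mathbb C$ and $h\in L^2(0,1)$. Then $$\big(\mathrm{Id}_m^{-1}(u'')+c\,\delta_1\,\big|\,h\big)_{H^{-1}(T)}=\left(\begin{pmatrix}c+u(1)\\ u(0)-u(1)\end{pmatrix}\Big|\begin{pmatrix}\mu_0(h)\\ \mu_1(h)\end{pmatrix}\right)_{\mathbb C^2}-(u|h)_{L^2}.$$
   Context: All spaces are complex; inner products are linear in the first argument. $H^1(T):=\{u\in H^1(0,1):u(0)=u(1)\}$, $H^{-1}(T)$ is its dual, with $f\in L^2(0,1)$ identified with $\varphi\mapsto\int_0^1 f\varphi\,dx$; $\delta_1\in H^{-1}(T)$ is evaluation at $1$. Put $\mu_0(\varphi):=\langle\varphi,1\rangle$ for $\varphi\in H^{-1}(T)$ and $\mu_1(f):=\int_0^1(1-x)f(x)\,dx$ for $f\in L^2(0,1)$. The operator $P:H^{-1}(T)\to L^2(0,1)$ (bounded) is defined by $\langle Pu,\varphi\rangle=\langle u,J\varphi\rangle$, $J\varphi(x):=\int_x^1\big(\varphi(y)-\int_0^1\varphi(z)dz\big)dy$. $H^{-1}(T)$ is equipped with the (equivalent) inner product $(f|g)_{H^{-1}(T)}:=(Pf|Pg)_{L^2}+\mu_0(f)\overline{\mu_0(g)}$. $H:=\{w\in H^{-1}(T):\mu_0(w)=0\}$. $\mathrm{Id}_m:H\to H^{-1}(0,1)=(H^1_0(0,1))'$ is the isomorphism restricting a functional to $H^1_0(0,1)$; explicitly $\langle \mathrm{Id}_m^{-1}\psi,v\rangle=\langle\psi,v-v(1)\rangle$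 for $\psi\in H^{-1}(0,1)$, $v\in H^1(T)$. For $u\in H^1(0,1)$, $u''\in H^{-1}(0,1)$ is the distributional second derivative. *)

theory Defs
  imports "HOL-Analysis.Analysis"
begin

text \<open>
  Elements of \<open>L\<^sup>2(0,1)\<close> are represented by functions on the real line of which only the restriction
  to \<open>(0,1)\<close> matters, up to null sets. Elements of \<open>H\<^sup>1(0,1)\<close> are represented by their continuous
  representative, of which only the restriction to \<open>[0,1]\<close> matters; this is what gives meaning to
  the boundary values \<open>u 0\<close> and \<open>u 1\<close>.
\<close>

abbreviation unit_interval_measure :: "real measure" where
  "unit_interval_measure \<equiv> lebesgue_on {0<..<1}"

definition L2 :: "(real \<Rightarrow> complex) set" where
  "L2 = {f \<in> borel_measurable unit_interval_measure.
           integrable unit_interval_measure (\<lambda>x. (cmod (f x))\<^sup>2)}"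

definition L2_pairing :: "(real \<Rightarrow> complex) \<Rightarrow> (real \<Rightarrow> complex) \<Rightarrow> complex" where
  "L2_pairing f g = (LINT x|unit_interval_measure. f x * g x)"

definition L2_inner :: "(real \<Rightarrow> complex) \<Rightarrow> (real \<Rightarrow> complex) \<Rightarrow> complex" where
  "L2_inner f g = (LINT x|unit_interval_measure. f x * cnj (g x))"

definition L2_norm :: "(real \<Rightarrow> complex) \<Rightarrow> real" where
  "L2_norm f = sqrt (LINT x|unit_interval_measure. (cmod (f x))\<^sup>2)"

definition D :: "(real \<Rightarrow> complex) \<Rightarrow> real \<Rightarrow> complex" where
  "D f = (\<lambda>x. vector_derivative f (at x))"

text \<open>The space \<open>C\<^sub>c\<^sup>\<infinity>(0,1)\<close>. A closed subset of the real line contained in \<open>(0,1)\<close> is compact.\<close>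

definition test_functions :: "(real \<Rightarrow> complex) set" where
  "test_functions = {\<phi>. (\<forall>n x. (D ^^ n) \<phi> differentiable (at x)) \<and> closure {x. \<phi> x \<noteq> 0} \<subseteq> {0<..<1}}"

definition has_weak_derivative :: "(real \<Rightarrow> complex) \<Rightarrow> (real \<Rightarrow> complex) \<Rightarrow> bool" where
  "has_weak_derivative u g \<longleftrightarrow>
     (\<forall>\<phi>\<in>test_functions. L2_pairing u (D \<phi>) = - L2_pairing g \<phi>)"

definition H1 :: "(real \<Rightarrow> complex) set" where
  "H1 = {u \<in> L2. continuous_on {0..1} u \<and> (\<exists>g\<in>L2. has_weak_derivative u g)}"

text \<open>For \<open>u \<in> H\<^sup>1(0,1)\<close> the weak derivative is unique up to null sets.\<close>

definition weak_derivative :: "(real \<Rightarrow> complex) \<Rightarrow> real \<Rightarrow> complex" where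
  "weak_derivative u = (SOME g. g \<in> L2 \<and> has_weak_derivative u g)"

definition H1_norm :: "(real \<Rightarrow> complex) \<Rightarrow> real" where
  "H1_norm u = sqrt ((L2_norm u)\<^sup>2 + (L2_norm (weak_derivative u))\<^sup>2)"

definition H1_T :: "(real \<Rightarrow> complex) set" where
  "H1_T = {u \<in> H1. u 0 = u 1}"

text \<open>\<open>H\<^sup>1\<^sub>0(0,1)\<close> is the closure of the test functions in \<open>H\<^sup>1(0,1)\<close>.\<close>

definition H1_0 :: "(real \<Rightarrow> complex) set" where
  "H1_0 = {v \<in> H1. \<forall>\<epsilon>>0. \<exists>\<phi>\<in>test_functions. H1_norm (\<lambda>x. v x - \<phi> x) < \<epsilon>}"

text \<open>
  The dual of a subspace \<open>V\<close> of \<open>H\<^sup>1(0,1)\<close>: complex-linear functionals on \<open>V\<close> that are bounded for the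
  \<open>H\<^sup>1\<close> norm. They are extended by \<open>0\<close> outside \<open>V\<close>, so that equality and addition of functionals on
  \<open>V\<close> are equality and pointwise addition in HOL. Boundedness forces a functional to take
  the same value on any two representatives of the same element of \<open>V\<close>.
\<close>

definition dual :: "(real \<Rightarrow> complex) set \<Rightarrow> ((real \<Rightarrow> complex) \<Rightarrow> complex) set" where
  "dual V = {F. (\<forall>v. v \<notin> V \<longrightarrow> F v = 0)
      \<and> (\<forall>v\<in>V. \<forall>w\<in>V. F (\<lambda>x. v x + w x) = F v + F w)
      \<and> (\<forall>a. \<forall>v\<in>V. F (\<lambda>x. a * v x) = a * F v)
      \<and> (\<exists>C. \<forall>v\<in>V. cmod (F v) \<le> C * H1_norm v)}"

definition Hm1_T :: "((real \<Rightarrow> complex) \<Rightarrow> complex) set" where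
  "Hm1_T = dual H1_T"

definition Hm1 :: "((real \<Rightarrow> complex) \<Rightarrow> complex) set" where
  "Hm1 = dual H1_0"

definition L2_to_Hm1_T :: "(real \<Rightarrow> complex) \<Rightarrow> (real \<Rightarrow> complex) \<Rightarrow> complex" where
  "L2_to_Hm1_T f = (\<lambda>v. if v \<in> H1_T then L2_pairing f v else 0)"

definition delta1 :: "(real \<Rightarrow> complex) \<Rightarrow> complex" where
  "delta1 = (\<lambda>v. if v \<in> H1_T then v 1 else 0)"

definition mu0 :: "((real \<Rightarrow> complex) \<Rightarrow> complex) \<Rightarrow> complex" where
  "mu0 F = F (\<lambda>_. 1)"

definition mu1 :: "(real \<Rightarrow> complex) \<Rightarrow> complex" where
  "mu1 f = (LINT x|unit_interval_measure. of_real (1 - x) * f x)"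

definition J :: "(real \<Rightarrow> complex) \<Rightarrow> real \<Rightarrow> complex" where
  "J \<phi> = (\<lambda>x. LINT y|lebesgue_on {x<..<1}. \<phi> y - (LINT z|unit_interval_measure. \<phi> z))"

text \<open>For \<open>F\<close> in \<open>H\<^sup>-\<^sup>1(T)\<close> the defining relation determines \<open>P F\<close> up to null sets.\<close>

definition P :: "((real \<Rightarrow> complex) \<Rightarrow> complex) \<Rightarrow> real \<Rightarrow> complex" where
  "P F = (SOME f. f \<in> L2 \<and> (\<forall>\<phi>\<in>L2. L2_pairing f \<phi> = F (J \<phi>)))"

definition Hm1_T_inner ::
    "((real \<Rightarrow> complex) \<Rightarrow> complex) \<Rightarrow> ((real \<Rightarrow> complex) \<Rightarrow> complex) \<Rightarrow> complex" where
  "Hm1_T_inner F G = L2_inner (P F) (P G) + mu0 F * cnj (mu0 G)"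

definition H :: "((real \<Rightarrow> complex) \<Rightarrow> complex) set" where
  "H = {w \<in> Hm1_T. mu0 w = 0}"

definition Id_m :: "((real \<Rightarrow> complex) \<Rightarrow> complex) \<Rightarrow> (real \<Rightarrow> complex) \<Rightarrow> complex" where
  "Id_m w = (\<lambda>v. if v \<in> H1_0 then w v else 0)"

definition Id_m_inv :: "((real \<Rightarrow> complex) \<Rightarrow> complex) \<Rightarrow> (real \<Rightarrow> complex) \<Rightarrow> complex" where
  "Id_m_inv = inv_into H Id_m"

text \<open>
  The distribution \<open>u''\<close> is \<open>\<phi> \<mapsto> \<integral> u \<phi>''\<close> on test functions; as an element of \<open>H\<^sup>-\<^sup>1(0,1)\<close> it is the
  bounded functional on \<open>H\<^sup>1\<^sub>0(0,1)\<close> extending it, unique by density of the test functions.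
\<close>

definition second_derivative :: "(real \<Rightarrow> complex) \<Rightarrow> (real \<Rightarrow> complex) \<Rightarrow> complex" where
  "second_derivative u =
     (THE \<psi>. \<psi> \<in> Hm1 \<and> (\<forall>\<phi>\<in>test_functions. \<psi> \<phi> = L2_pairing u (D (D \<phi>))))"

definition C2_inner :: "complex ^ 2 \<Rightarrow> complex ^ 2 \<Rightarrow> complex" where
  "C2_inner x y = (\<Sum>i\<in>UNIV. x $ i * cnj (y $ i))"

end

theory Submission
  imports Defs
begin

text \<open>
  Write \<open>F\<close> for the first argument of the inner product, \<open>g = u'\<close> and \<open>a = u 1 - u 0\<close>. Functions
  \<open>J \<phi>\<close> vanish at both end points, so \<open>delta1\<close> does not contribute to \<open>P F\<close>, and \<open>Id_m_inv\<close> enters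
  only through its values on \<open>H1_0\<close>; hence \<open>P F = g - a\<close>. Exchanging the order of integration gives
  \<open>P h x = (\<integral>\<^sub>0\<^sup>x h) - mu1 h\<close>, and one more exchange evaluates the \<open>L\<^sup>2\<close> product of the two.
  All this needs that an \<open>H\<^sup>1\<close> function is the primitive of its weak derivative and that \<open>H1_0\<close>, defined
  as a closure, consists of the \<open>H\<^sup>1\<close> functions vanishing at the end points. Both follow from the
  density of the test functions in \<open>L\<^sup>2\<close>.
\<close>

section \<open>Square-integrable functions on the unit interval\<close>

text \<open>\<open>J \<phi>\<close> sees only \<open>\<phi>\<close> minus its mean, so
  \<open>P\<close> maps functionals in \<open>Hm1_T\<close> to functions of mean zero; accordingly
  the constants \<open>a\<close> and \<open>mu1 h\<close> are the means of \<open>g\<close> and of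
  the primitive \<open>lower h\<close>. In the product of \<open>g - a\<close> with the conjugate of
  \<open>lower h - mu1 h\<close> the constant terms collapse to \<open>- a * cnj (mu1 h)\<close>,
  the second component on the right-hand side. The remaining term is moved, by the adjointness of
  \<open>lower\<close> and \<open>upper\<close>, to the pairing of \<open>upper g = u 1 - u\<close>
  with \<open>cnj h\<close>, which yields \<open>u 1\<close> and \<open>- L2_inner u h\<close>. The
  constant \<open>c\<close> enters only through \<open>mu0\<close>, which annihilates
  \<open>H\<close>. The obstacle is that \<open>P\<close> and \<open>weak_derivative\<close> are
  choices, \<open>second_derivative\<close> is a definite description and \<open>Id_m_inv\<close>
  picks a preimage. Each needs an existence proof, and the chosen functions are known only up to
  null sets, so identities between them are used inside integrals.\<close>

lemma space_unit [simp]: "space unit_interval_measure = {0<..<1}"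
  by simp

lemma sets_unit_iff: "A \<in> sets unit_interval_measure \<longleftrightarrow> A \<in> sets lebesgue \<and> A \<subseteq> {0<..<1}"
  by (subst sets_restrict_space_iff) auto

lemma finite_measure_unit [simp, intro]: "finite_measure unit_interval_measure"
  by (rule finite_measure_lebesgue_on) auto

lemma measure_unit [simp]: "measure unit_interval_measure {0<..<1} = 1"
  by (simp add: measure_restrict_space)

lemma L2_measurable [measurable_dest]: "f \<in> L2 \<Longrightarrow> f \<in> borel_measurable unit_interval_measure"
  by (simp add: L2_def)

lemma L2_integrable_square: "f \<in> L2 \<Longrightarrow> integrable unit_interval_measure (\<lambda>x. (cmod (f x))\<^sup>2)"
  by (simp add: L2_def)

lemma L2_bounded:
  assumes [measurable]: "f \<in> borel_measurable unit_interval_measure"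
    and "\<And>x. x \<in> {0<..<1} \<Longrightarrow> cmod (f x) \<le> B"
  shows "f \<in> L2"
  unfolding L2_def
proof safe
  interpret finite_measure unit_interval_measure by simp
  show "integrable unit_interval_measure (\<lambda>x. (cmod (f x))\<^sup>2)"
    by (rule integrable_const_bound[where B = "B\<^sup>2"])
       (auto intro!: AE_I2 power_mono assms)
qed (use assms in auto)

lemma L2_const [simp]: "(\<lambda>_. a) \<in> L2"
  by (rule L2_bounded) auto

lemma L2_add [intro]:
  assumes "f \<in> L2" "g \<in> L2"
  shows "(\<lambda>x. f x + g x) \<in> L2"
  unfolding L2_def
proof safe
  note [measurable] = assms[THEN L2_measurable]
  show [measurable]: "(\<lambda>x. f x + g x) \<in> borel_measurable unit_interval_measure"
    by simp
  show "integrable unit_interval_measure (\<lambda>x. (cmod (f x + g x))\<^sup>2)"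
  proof (rule Bochner_Integration.integrable_bound)
    show "integrable unit_interval_measure (\<lambda>x. 2 * (cmod (f x))\<^sup>2 + 2 * (cmod (g x))\<^sup>2)"
      using assms by (intro Bochner_Integration.integrable_add integrable_mult_right L2_integrable_square)
    have "(cmod (f x + g x))\<^sup>2 \<le> 2 * (cmod (f x))\<^sup>2 + 2 * (cmod (g x))\<^sup>2" for x
    proof -
      have "(cmod (f x + g x))\<^sup>2 \<le> (cmod (f x) + cmod (g x))\<^sup>2"
        by (intro power_mono norm_triangle_ineq) auto
      also have "\<dots> \<le> 2 * (cmod (f x))\<^sup>2 + 2 * (cmod (g x))\<^sup>2"
        using sum_squares_bound[of "cmod (f x)" "cmod (g x)"] by (simp add: power2_sum)
      finally show ?thesis .
    qed
    then show "AE x in unit_interval_measure. norm ((cmod (f x + g x))\<^sup>2)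
        \<le> norm (2 * (cmod (f x))\<^sup>2 + 2 * (cmod (g x))\<^sup>2)"
      by (intro AE_I2) auto
  qed measurable
qed

lemma L2_cmult [intro]:
  assumes "f \<in> L2"
  shows "(\<lambda>x. a * f x) \<in> L2"
  using assms by (auto simp: L2_def norm_mult power_mult_distrib)

lemma L2_uminus [intro]: "f \<in> L2 \<Longrightarrow> (\<lambda>x. - f x) \<in> L2"
  using L2_cmult[of f "-1"] by simp

lemma L2_diff [intro]: "f \<in> L2 \<Longrightarrow> g \<in> L2 \<Longrightarrow> (\<lambda>x. f x - g x) \<in> L2"
  using L2_add[of f "\<lambda>x. - g x"] by auto

lemma L2_cnj [intro]: "f \<in> L2 \<Longrightarrow> (\<lambda>x. cnj (f x)) \<in> L2"
  by (auto simp: L2_def intro!: borel_measurable_continuous_on[where f = cnj] continuous_on_cnj continuous_on_id)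

lemma L2_sum [intro]: "(\<And>i. i \<in> A \<Longrightarrow> f i \<in> L2) \<Longrightarrow> (\<lambda>x. \<Sum>i\<in>A. f i x) \<in> L2"
  by (induction A rule: infinite_finite_induct) auto

lemma L2_cong_AE:
  assumes "f \<in> L2" "AE x in unit_interval_measure. f x = g x"
    and [measurable]: "g \<in> borel_measurable unit_interval_measure"
  shows "g \<in> L2"
proof -
  note [measurable] = assms(1)[THEN L2_measurable]
  have "integrable unit_interval_measure (\<lambda>x. (cmod (g x))\<^sup>2)"
    using L2_integrable_square[OF assms(1)]
    by (rule iffD1[OF integrable_cong_AE, rotated 3]) (use assms(2) in auto)
  then show ?thesis by (simp add: L2_def)
qed

section \<open>Products, the Cauchy-Schwarz inequality and the \<open>L2\<close> norm\<close>

lemma L2_integrable_norm_mult: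
  assumes "f \<in> L2" "g \<in> L2"
  shows "integrable unit_interval_measure (\<lambda>x. cmod (f x) * cmod (g x))"
proof (rule Bochner_Integration.integrable_bound)
  note [measurable] = assms[THEN L2_measurable]
  show "integrable unit_interval_measure (\<lambda>x. (cmod (f x))\<^sup>2 + (cmod (g x))\<^sup>2)"
    using assms by (auto dest: L2_integrable_square)
  show "(\<lambda>x. cmod (f x) * cmod (g x)) \<in> borel_measurable unit_interval_measure"
    by measurable
  have "cmod (f x) * cmod (g x) \<le> (cmod (f x))\<^sup>2 + (cmod (g x))\<^sup>2" for x
    using sum_squares_bound[of "cmod (f x)" "cmod (g x)"]
      mult_nonneg_nonneg[OF norm_ge_zero[of "f x"] norm_ge_zero[of "g x"]]
    by (simp only: mult.assoc)
  then show "AE x in unit_interval_measure. norm (cmod (f x) * cmod (g x))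
        \<le> norm ((cmod (f x))\<^sup>2 + (cmod (g x))\<^sup>2)"
    by (intro AE_I2) auto
qed

lemma L2_integrable_mult [intro]:
  assumes "f \<in> L2" "g \<in> L2"
  shows "integrable unit_interval_measure (\<lambda>x. f x * g x)"
proof -
  note [measurable] = assms[THEN L2_measurable]
  show ?thesis
    by (rule Bochner_Integration.integrable_bound[OF L2_integrable_norm_mult[OF assms]])
       (auto simp: norm_mult)
qed

lemma L2_integrable [intro]: "f \<in> L2 \<Longrightarrow> integrable unit_interval_measure f"
  using L2_integrable_mult[of f "\<lambda>_. 1"] by simp

lemma L2_norm_square: "(L2_norm f)\<^sup>2 = (LINT x|unit_interval_measure. (cmod (f x))\<^sup>2)"
  by (simp add: L2_norm_def)

lemma L2_norm_nonneg [simp]: "0 \<le> L2_norm f"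
  by (simp add: L2_norm_def)

text \<open>The integral of \<open>(cmod (f x) - t * cmod (g x))\<^sup>2\<close> is a nonnegative
  quadratic polynomial in \<open>t\<close>; its discriminant gives the bound.\<close>

lemma L2_Cauchy_Schwarz_norm:
  assumes "f \<in> L2" "g \<in> L2"
  shows "(LINT x|unit_interval_measure. cmod (f x) * cmod (g x)) \<le> L2_norm f * L2_norm g"
proof -
  define b where "b = (LINT x|unit_interval_measure. cmod (f x) * cmod (g x))"
  have int: "integrable unit_interval_measure (\<lambda>x. (cmod (f x))\<^sup>2)"
      "integrable unit_interval_measure (\<lambda>x. (cmod (g x))\<^sup>2)"
      "integrable unit_interval_measure (\<lambda>x. cmod (f x) * cmod (g x))"
    using assms by (auto intro: L2_integrable_square L2_integrable_norm_mult)
  have quad: "0 \<le> (L2_norm f)\<^sup>2 - 2 * t * b + t\<^sup>2 * (L2_norm g)\<^sup>2" for t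
  proof -
    have "0 \<le> (LINT x|unit_interval_measure. (cmod (f x) - t * cmod (g x))\<^sup>2)"
      by simp
    also have "\<dots> = (LINT x|unit_interval_measure.
        (cmod (f x))\<^sup>2 - 2 * t * (cmod (f x) * cmod (g x)) + t\<^sup>2 * (cmod (g x))\<^sup>2)"
      by (intro Bochner_Integration.integral_cong) (auto simp: power2_eq_square algebra_simps)
    also have "\<dots> = (L2_norm f)\<^sup>2 - 2 * t * b + t\<^sup>2 * (L2_norm g)\<^sup>2"
      using int by (simp add: L2_norm_square b_def)
    finally show ?thesis .
  qed
  have "b\<^sup>2 \<le> (L2_norm f * L2_norm g)\<^sup>2"
  proof (cases "L2_norm g = 0")
    case True
    have "b = 0"
    proof (rule ccontr)
      assume "b \<noteq> 0"
      \<comment> \<open>For \<open>L2_norm g = 0\<close> the polynomial in \<open>quad\<close> is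
        affine in \<open>t\<close>; at this \<open>t\<close> it takes the value -1.\<close>
      with quad[of "((L2_norm f)\<^sup>2 + 1) / (2 * b)"] True show False by simp
    qed
    then show ?thesis by simp
  next
    case False
    then have pos: "0 < (L2_norm g)\<^sup>2"
      by simp
    have "0 \<le> (L2_norm f)\<^sup>2 - b\<^sup>2 / (L2_norm g)\<^sup>2"
    proof -
      \<comment> \<open>The value \<open>b / (L2_norm g)\<^sup>2\<close> is the minimiser of the
        quadratic.\<close>
      have "(b / (L2_norm g)\<^sup>2)\<^sup>2 * (L2_norm g)\<^sup>2 = b\<^sup>2 / (L2_norm g)\<^sup>2"
        using pos by (simp add: field_simps power2_eq_square)
      with quad[of "b / (L2_norm g)\<^sup>2"] show ?thesis
        by (simp add: power2_eq_square[of b])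
    qed
    with pos show ?thesis
      by (simp add: field_simps power_mult_distrib)
  qed
  then show ?thesis
    unfolding b_def by (rule power2_le_imp_le) simp
qed

lemma L2_Cauchy_Schwarz:
  assumes "f \<in> L2" "g \<in> L2"
  shows "cmod (L2_pairing f g) \<le> L2_norm f * L2_norm g"
proof -
  have "cmod (L2_pairing f g) \<le> (LINT x|unit_interval_measure. cmod (f x * g x))"
    unfolding L2_pairing_def by (rule integral_norm_bound)
  also have "\<dots> \<le> L2_norm f * L2_norm g"
    using L2_Cauchy_Schwarz_norm[OF assms] by (simp add: norm_mult)
  finally show ?thesis .
qed

lemma L2_norm_triangle:
  assumes "f \<in> L2" "g \<in> L2"
  shows "L2_norm (\<lambda>x. f x + g x) \<le> L2_norm f + L2_norm g"
proof (rule power2_le_imp_le)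
  have int: "integrable unit_interval_measure (\<lambda>x. (cmod (f x))\<^sup>2)"
      "integrable unit_interval_measure (\<lambda>x. (cmod (g x))\<^sup>2)"
      "integrable unit_interval_measure (\<lambda>x. cmod (f x) * cmod (g x))"
    using assms by (auto intro: L2_integrable_square L2_integrable_norm_mult)
  have "(L2_norm (\<lambda>x. f x + g x))\<^sup>2 = (LINT x|unit_interval_measure. (cmod (f x + g x))\<^sup>2)"
    by (rule L2_norm_square)
  also have "\<dots> \<le> (LINT x|unit_interval_measure.
      (cmod (f x))\<^sup>2 + 2 * (cmod (f x) * cmod (g x)) + (cmod (g x))\<^sup>2)"
  proof (rule integral_mono)
    show "integrable unit_interval_measure (\<lambda>x. (cmod (f x + g x))\<^sup>2)"
      using L2_integrable_square[OF L2_add[OF assms]] .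
    show "(cmod (f x + g x))\<^sup>2 \<le> (cmod (f x))\<^sup>2 + 2 * (cmod (f x) * cmod (g x)) + (cmod (g x))\<^sup>2" for x
      using power_mono[OF norm_triangle_ineq[of "f x" "g x"], of 2] by (simp add: power2_sum)
  qed (use int in auto)
  also have "\<dots> = (L2_norm f)\<^sup>2 + 2 * (LINT x|unit_interval_measure. cmod (f x) * cmod (g x)) + (L2_norm g)\<^sup>2"
    using int by (simp add: L2_norm_square)
  also have "\<dots> \<le> (L2_norm f + L2_norm g)\<^sup>2"
    using L2_Cauchy_Schwarz_norm[OF assms] by (simp add: power2_sum)
  finally show "(L2_norm (\<lambda>x. f x + g x))\<^sup>2 \<le> (L2_norm f + L2_norm g)\<^sup>2" .
qed simp

lemma L2_norm_cmult: "L2_norm (\<lambda>x. a * f x) = cmod a * L2_norm f"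
  by (simp add: L2_norm_def norm_mult power_mult_distrib real_sqrt_mult)

lemma L2_norm_cong_AE:
  assumes "AE x in unit_interval_measure. f x = g x"
    and [measurable]: "f \<in> borel_measurable unit_interval_measure" "g \<in> borel_measurable unit_interval_measure"
  shows "L2_norm f = L2_norm g"
  unfolding L2_norm_def by (intro arg_cong[where f = sqrt] integral_cong_AE) (use assms(1) in auto)

lemma L2_pairing_cong_AE:
  assumes "AE x in unit_interval_measure. f x = g x"
    and [measurable]: "f \<in> borel_measurable unit_interval_measure" "g \<in> borel_measurable unit_interval_measure"
      "h \<in> borel_measurable unit_interval_measure"
  shows "L2_pairing f h = L2_pairing g h"
  unfolding L2_pairing_def by (intro integral_cong_AE) (use assms(1) in auto)

lemma L2_norm_le_bound:
  assumes "f \<in> L2" "\<And>x. x \<in> {0<..<1} \<Longrightarrow> cmod (f x) \<le> B" "0 \<le> B"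
  shows "L2_norm f \<le> B"
proof (rule power2_le_imp_le)
  have "(L2_norm f)\<^sup>2 \<le> (LINT x|unit_interval_measure. B\<^sup>2)"
    unfolding L2_norm_square using L2_integrable_square[OF assms(1)]
    by (intro integral_mono) (auto intro!: power_mono assms finite_measure.integrable_const)
  then show "(L2_norm f)\<^sup>2 \<le> B\<^sup>2" by simp
qed (fact assms)

lemma L2_norm_1: "L2_norm (\<lambda>_. 1) = 1"
  by (simp add: L2_norm_def)

lemma L2_pairing_commute: "L2_pairing f g = L2_pairing g f"
  by (simp add: L2_pairing_def mult.commute)

lemma L2_pairing_add_left:
  assumes "f \<in> L2" "g \<in> L2" "h \<in> L2"
  shows "L2_pairing (\<lambda>x. f x + g x) h = L2_pairing f h + L2_pairing g h"
  unfolding L2_pairing_def distrib_right using assms by (intro Bochner_Integration.integral_add) auto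

lemma L2_pairing_cmult_left: "L2_pairing (\<lambda>x. a * f x) h = a * L2_pairing f h"
  by (simp add: L2_pairing_def mult.assoc)

lemma L2_pairing_diff_left:
  assumes "f \<in> L2" "g \<in> L2" "h \<in> L2"
  shows "L2_pairing (\<lambda>x. f x - g x) h = L2_pairing f h - L2_pairing g h"
  unfolding L2_pairing_def left_diff_distrib using assms by (intro Bochner_Integration.integral_diff) auto

lemma L2_pairing_diff_right:
  assumes "f \<in> L2" "g \<in> L2" "h \<in> L2"
  shows "L2_pairing h (\<lambda>x. f x - g x) = L2_pairing h f - L2_pairing h g"
  using L2_pairing_diff_left[OF assms] by (simp add: L2_pairing_commute)

lemma L2_norm_0_imp_AE:
  assumes "f \<in> L2" "L2_norm f = 0"
  shows "AE x in unit_interval_measure. f x = 0"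
proof -
  have "(LINT x|unit_interval_measure. (cmod (f x))\<^sup>2) = 0"
    using assms(2) by (metis L2_norm_square zero_power2)
  then have "AE x in unit_interval_measure. (cmod (f x))\<^sup>2 = 0"
    using L2_integrable_square[OF assms(1)] by (subst (asm) integral_nonneg_eq_0_iff_AE) auto
  then show ?thesis by simp
qed

section \<open>Smooth functions\<close>

definition smooth :: "(real \<Rightarrow> complex) \<Rightarrow> bool" where
  "smooth f \<longleftrightarrow> (\<forall>n x. (D ^^ n) f differentiable (at x))"

lemma smooth_has_vector_derivative:
  assumes "smooth f"
  shows "(f has_vector_derivative D f x) (at x)"
proof -
  have "((D ^^ 0) f) differentiable (at x)"
    using assms unfolding smooth_def by blast
  then show ?thesis
    by (simp add: D_def vector_derivative_works)
qed

lemma smooth_D: "smooth f \<Longrightarrow> smooth (D f)"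
  unfolding smooth_def by (metis funpow_Suc_right comp_apply)

lemma smooth_continuous: "smooth f \<Longrightarrow> continuous_on A f"
  by (meson continuous_at_imp_continuous_on has_vector_derivative_continuous smooth_has_vector_derivative)

lemma D_eqI:
  assumes "\<And>x. (f has_vector_derivative g x) (at x)"
  shows "D f = g"
  unfolding D_def using vector_derivative_at[OF assms] by blast

text \<open>Smoothness as a greatest fixed point: it suffices to exhibit a family closed under
  differentiation. The alternative \<open>smooth g\<close> lets a derivative leave the family once
  it is known to be smooth.\<close>

lemma smooth_coinduct [consumes 1, case_names deriv]:
  assumes "f \<in> X"
    and "\<And>f. f \<in> X \<Longrightarrow> \<exists>g. (g \<in> X \<or> smooth g) \<and> (\<forall>x. (f has_vector_derivative g x) (at x))"
  shows "smooth f"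
  unfolding smooth_def
proof (intro allI)
  fix n x
  show "(D ^^ n) f differentiable (at x)"
    using assms(1)
  proof (induction n arbitrary: f)
    case 0
    from assms(2)[OF this] show ?case
      by (auto intro: differentiableI_vector)
  next
    case (Suc n)
    obtain g where g: "g \<in> X \<or> smooth g" "\<forall>x. (f has_vector_derivative g x) (at x)"
      using assms(2)[OF Suc.prems] by blast
    have "(D ^^ Suc n) f = (D ^^ n) g"
      using D_eqI[of f g] g(2) by (simp add: funpow_Suc_right del: funpow.simps)
    then show ?case
      using g(1) Suc.IH by (auto simp: smooth_def)
  qed
qed

section \<open>Closure properties of smooth functions\<close>

lemma smooth_const: "smooth (\<lambda>_. a)"
proof -
  have "(\<lambda>_. a) \<in> range (\<lambda>a _. a)"
    by simp
  then show ?thesis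
    by (coinduct rule: smooth_coinduct) (auto intro!: exI[of _ "\<lambda>_. 0"])
qed

lemma smooth_add:
  assumes "smooth f" "smooth g"
  shows "smooth (\<lambda>x. f x + g x)"
proof -
  have "(\<lambda>x. f x + g x) \<in> {\<lambda>x. f x + g x |f g. smooth f \<and> smooth g}"
    using assms by blast
  then show ?thesis
  proof (coinduct rule: smooth_coinduct)
    case (deriv h)
    then obtain f g where h: "h = (\<lambda>x. f x + g x)" "smooth f" "smooth g"
      by blast
    then have "\<forall>x. (h has_vector_derivative D f x + D g x) (at x)"
      by (auto intro: has_vector_derivative_add smooth_has_vector_derivative)
    then show ?case
      using h(2,3) smooth_D by (intro exI[of _ "\<lambda>x. D f x + D g x"]) auto
  qed
qed

text \<open>The product rule turns one product into a sum of two, so products alone are not closed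
  under differentiation; their finite sums are.\<close>

inductive product_sum :: "(real \<Rightarrow> complex) \<Rightarrow> bool" where
  mult: "smooth f \<Longrightarrow> smooth g \<Longrightarrow> product_sum (\<lambda>x. f x * g x)"
| add: "product_sum f \<Longrightarrow> product_sum g \<Longrightarrow> product_sum (\<lambda>x. f x + g x)"

lemma smooth_mult:
  assumes "smooth f" "smooth g"
  shows "smooth (\<lambda>x. f x * g x)"
proof -
  have "(\<lambda>x. f x * g x) \<in> Collect product_sum"
    using assms by (auto intro: product_sum.mult)
  then show ?thesis
  proof (coinduct rule: smooth_coinduct)
    case (deriv h)
    then have "product_sum h" by simp
    then show ?case
    proof (induction h)
      case (mult f g)
      have "\<forall>x. ((\<lambda>x. f x * g x) has_vector_derivative f x * D g x + D f x * g x) (at x)"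
        using mult by (auto intro: has_vector_derivative_mult smooth_has_vector_derivative)
      moreover have "product_sum (\<lambda>x. f x * D g x + D f x * g x)"
        using mult by (intro product_sum.intros smooth_D)
      ultimately show ?case by blast
    next
      case (add f g)
      then obtain f' g' where *: "product_sum f' \<or> smooth f'" "product_sum g' \<or> smooth g'"
          "\<forall>x. (f has_vector_derivative f' x) (at x)" "\<forall>x. (g has_vector_derivative g' x) (at x)"
        by auto
      \<comment> \<open>A derivative known only to be smooth enters the family as the product
        \<open>1 * k\<close>.\<close>
      have ps: "product_sum k" if "product_sum k \<or> smooth k" for k
        using that product_sum.mult[OF smooth_const[of 1], of k] by auto
      have "product_sum (\<lambda>x. f' x + g' x)"
        using * ps by (intro product_sum.add) auto
      with * show ?case
        by (intro exI[of _ "\<lambda>x. f' x + g' x"]) (auto intro: has_vector_derivative_add)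
    qed
  qed
qed

lemma smooth_cmult: "smooth f \<Longrightarrow> smooth (\<lambda>x. a * f x)"
  by (intro smooth_mult smooth_const)

lemma smooth_affine:
  assumes "smooth f"
  shows "smooth (\<lambda>x. f (a * x + b))"
proof -
  \<comment> \<open>The scalar \<open>c\<close> absorbs the factors \<open>a\<close> that the chain
    rule produces.\<close>
  have "(\<lambda>x. f (a * x + b)) \<in> {\<lambda>x. c * f (a * x + b) |c f. smooth f}"
    using assms by (auto intro!: exI[of _ 1] exI[of _ f])
  then show ?thesis
  proof (coinduct rule: smooth_coinduct)
    case (deriv h)
    then obtain c f where h: "h = (\<lambda>x. c * f (a * x + b))" "smooth f"
      by blast
    have "(h has_vector_derivative (c * of_real a) * D f (a * x + b)) (at x)" for x
    proof -
      have "((\<lambda>x. a * x + b) has_vector_derivative a) (at x)"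
        by (auto intro!: derivative_eq_intros simp flip: has_real_derivative_iff_has_vector_derivative)
      then have "((f \<circ> (\<lambda>x. a * x + b)) has_vector_derivative a *\<^sub>R D f (a * x + b)) (at x)"
        by (rule vector_diff_chain_at) (rule smooth_has_vector_derivative[OF h(2)])
      then have "((\<lambda>x. c * (f \<circ> (\<lambda>x. a * x + b)) x) has_vector_derivative c * (a *\<^sub>R D f (a * x + b))) (at x)"
        by (rule has_vector_derivative_mult_right)
      then show ?thesis
        by (simp add: h o_def scaleR_conv_of_real mult_ac)
    qed
    then show ?case
      using smooth_D[OF h(2)] by (intro exI[of _ "\<lambda>x. (c * of_real a) * D f (a * x + b)"]) blast
  qed
qed

text \<open>The polynomial factor makes the family closed under differentiation.\<close>

definition flat :: "real poly \<Rightarrow> real \<Rightarrow> complex" where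
  "flat p x = (if x > 0 then of_real (poly p (1 / x) * exp (- (1 / x))) else 0)"

lemma poly_times_exp_minus_tendsto_0: "((\<lambda>y::real. poly p y * exp (- y)) \<longlongrightarrow> 0) at_top"
proof -
  have "((\<lambda>y::real. \<Sum>i\<le>degree p. coeff p i * (y ^ i / exp y)) \<longlongrightarrow> (\<Sum>i\<le>degree p. coeff p i * 0)) at_top"
    by (intro tendsto_intros tendsto_power_div_exp_0)
  then show ?thesis
    by (simp add: poly_altdef sum_distrib_right sum_divide_distrib exp_minus field_simps)
qed

text \<open>With \<open>y = 1 / x\<close>, differentiating \<open>poly p y * exp (- y)\<close> in
  \<open>x\<close> gives \<open>y\<^sup>2 * (p - p') y * exp (- y)\<close>, and
  \<open>[:0, 0, 1:]\<close> is the factor \<open>y\<^sup>2\<close>. At 0 the exponential decay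
  beats every polynomial.\<close>

lemma flat_has_vector_derivative:
  "(flat p has_vector_derivative flat ([:0, 0, 1:] * (p - pderiv p)) x) (at x)"
proof -
  consider "x > 0" | "x < 0" | "x = 0" by linarith
  then show ?thesis
  proof cases
    case 1
    let ?g = "\<lambda>x. poly p (1 / x) * exp (- (1 / x))"
    let ?d = "poly ([:0, 0, 1:] * (p - pderiv p)) (1 / x) * exp (- (1 / x))"
    have "(?g has_real_derivative ?d) (at x)"
      using 1 by (auto intro!: derivative_eq_intros DERIV_chain'[OF _ poly_DERIV]
          simp: field_simps power2_eq_square)
    then have "((\<lambda>x. of_real (?g x) :: complex) has_vector_derivative of_real ?d) (at x)"
      by (rule has_vector_derivative_of_real)
    then have "(flat p has_vector_derivative of_real ?d) (at x)"
      by (rule has_vector_derivative_transform_within_open[where S = "{0<..}"]) (use 1 in \<open>auto simp: flat_def\<close>)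
    then show ?thesis using 1 by (simp add: flat_def)
  next
    case 2
    have "((\<lambda>_. 0) has_vector_derivative 0) (at x)" by simp
    then have "(flat p has_vector_derivative 0) (at x)"
      by (rule has_vector_derivative_transform_within_open[where S = "{..<0}"]) (use 2 in \<open>auto simp: flat_def\<close>)
    then show ?thesis using 2 by (simp add: flat_def)
  next
    case 3
    \<comment> \<open>The right difference quotient of \<open>flat p\<close> at 0 is
      \<open>y * poly p y * exp (- y)\<close> with \<open>y = 1 / h\<close>; the factor
      \<open>[:0, 1:]\<close> accounts for the division by \<open>h\<close>.\<close>
    have "((\<lambda>h. poly ([:0, 1:] * p) (1 / h) * exp (- (1 / h))) \<longlongrightarrow> 0) (at_right 0)"
      using poly_times_exp_minus_tendsto_0[of "[:0, 1:] * p"] filterlim_inverse_at_top_right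
      unfolding inverse_eq_divide by (rule filterlim_compose)
    then have "((\<lambda>h. of_real (poly ([:0, 1:] * p) (1 / h) * exp (- (1 / h))) :: complex) \<longlongrightarrow> of_real 0) (at_right 0)"
      by (rule tendsto_of_real)
    moreover have "\<forall>\<^sub>F h in at_right (0::real). of_real (poly ([:0, 1:] * p) (1 / h) * exp (- (1 / h))) = flat p h /\<^sub>R h"
      unfolding eventually_at_right_field
      by (intro exI[of _ 1]) (auto simp: flat_def scaleR_conv_of_real field_simps)
    ultimately have "((\<lambda>h. flat p h /\<^sub>R h) \<longlongrightarrow> 0) (at_right 0)"
      by (simp add: tendsto_cong)
    moreover have "((\<lambda>h. flat p h /\<^sub>R h) \<longlongrightarrow> 0) (at_left 0)"
    proof (rule tendsto_eventually)
      show "\<forall>\<^sub>F h in at_left 0. flat p h /\<^sub>R h = 0"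
        unfolding eventually_at_left_field by (intro exI[of _ "-1"]) (auto simp: flat_def)
    qed
    ultimately have "((\<lambda>h. flat p h /\<^sub>R h) \<longlongrightarrow> 0) (at 0)"
      by (simp add: filterlim_split_at)
    then have "((\<lambda>h. norm (flat p h) / norm h) \<longlongrightarrow> 0) (at 0)"
      by (drule_tac tendsto_norm_zero) (simp add: divide_inverse mult.commute)
    then have "(flat p has_vector_derivative 0) (at 0)"
      by (simp add: has_vector_derivative_def has_derivative_at flat_def)
    with 3 show ?thesis by (simp add: flat_def)
  qed
qed

lemma smooth_flat: "smooth (flat p)"
proof -
  have "flat p \<in> range flat" by simp
  then show ?thesis
    by (coinduct rule: smooth_coinduct) (use flat_has_vector_derivative in blast)
qed

section \<open>Test functions and primitives\<close>

lemma test_functions_iff: "\<phi> \<in> test_functions \<longleftrightarrow> smooth \<phi> \<and> closure {x. \<phi> x \<noteq> 0} \<subseteq> {0<..<1}"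
  by (auto simp: test_functions_def smooth_def)

lemma test_functionsI:
  assumes "smooth \<phi>" "0 < a" "b < 1" "\<And>x. x < a \<or> b < x \<Longrightarrow> \<phi> x = 0"
  shows "\<phi> \<in> test_functions"
proof -
  have "{x. \<phi> x \<noteq> 0} \<subseteq> {a..b}"
    using assms(4) by force
  then have "closure {x. \<phi> x \<noteq> 0} \<subseteq> {a..b}"
    by (simp add: closure_minimal)
  also have "\<dots> \<subseteq> {0<..<1}"
    using assms by auto
  finally show ?thesis
    using assms(1) by (simp add: test_functions_iff)
qed

lemma test_functionsE:
  assumes "\<phi> \<in> test_functions"
  obtains a b where "smooth \<phi>" "0 < a" "a < b" "b < 1" "\<forall>x. x \<le> a \<or> b \<le> x \<longrightarrow> \<phi> x = 0"
proof -
  \<comment> \<open>Inserting 1/2 keeps \<open>K\<close> nonempty for the zero function, so that its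
    extrema exist.\<close>
  define K where "K = insert (1/2) (closure {x. \<phi> x \<noteq> 0})"
  have K: "smooth \<phi>" "K \<subseteq> {0<..<1}" "K \<noteq> {}"
    using assms by (auto simp: test_functions_iff K_def)
  then have "bounded K"
    using bounded_subset[OF bounded_box[of 0 "1::real"], of K] by simp
  then have "compact K"
    by (simp add: K_def compact_eq_bounded_closed)
  then obtain s t where st: "s \<in> K" "t \<in> K" "\<And>x. x \<in> K \<Longrightarrow> s \<le> x" "\<And>x. x \<in> K \<Longrightarrow> x \<le> t"
    using compact_attains_inf[of K] compact_attains_sup[of K] K(3) by blast
  have "\<phi> x = 0" if "x < s \<or> t < x" for x
  proof (rule ccontr)
    assume "\<phi> x \<noteq> 0"
    then have "x \<in> closure {x. \<phi> x \<noteq> 0}"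
      by (intro subsetD[OF closure_subset]) simp
    with st(3,4)[of x] that show False by (simp add: K_def)
  qed
  moreover have "0 < s" "s \<le> t" "t < 1"
    using st K by auto
  \<comment> \<open>Moving halfway from the extrema of \<open>K\<close> towards 0 and 1 makes
    \<open>\<phi>\<close> vanish at the new bounds themselves and gives \<open>a < b\<close>
    strictly.\<close>
  ultimately show ?thesis
    by (intro that[of "s / 2" "(t + 1) / 2"]) (use K in auto)
qed

lemma test_functions_add:
  assumes "\<phi> \<in> test_functions" "\<psi> \<in> test_functions"
  shows "(\<lambda>x. \<phi> x + \<psi> x) \<in> test_functions"
proof -
  obtain a b where ab: "smooth \<phi>" "0 < a" "a < b" "b < 1" "\<forall>x. x \<le> a \<or> b \<le> x \<longrightarrow> \<phi> x = 0"
    by (rule test_functionsE[OF assms(1)])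
  obtain c d where cd: "smooth \<psi>" "0 < c" "c < d" "d < 1" "\<forall>x. x \<le> c \<or> d \<le> x \<longrightarrow> \<psi> x = 0"
    by (rule test_functionsE[OF assms(2)])
  show ?thesis
    by (rule test_functionsI[of _ "min a c" "max b d"]) (use ab cd smooth_add in auto)
qed

lemma test_functions_cmult:
  assumes "\<phi> \<in> test_functions"
  shows "(\<lambda>x. a * \<phi> x) \<in> test_functions"
  using assms by (elim test_functionsE, intro test_functionsI smooth_cmult) auto

lemma test_functions_diff:
  assumes "\<phi> \<in> test_functions" "\<psi> \<in> test_functions"
  shows "(\<lambda>x. \<phi> x - \<psi> x) \<in> test_functions"
  using test_functions_add[OF assms(1) test_functions_cmult[OF assms(2), of "-1"]] by simp

lemma test_functions_0: "(\<lambda>_. 0) \<in> test_functions"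
  by (rule test_functionsI[of _ "1/3" "2/3"]) (auto intro: smooth_const)

lemma test_functions_D:
  assumes "\<phi> \<in> test_functions"
  shows "D \<phi> \<in> test_functions"
proof -
  obtain a b where ab: "smooth \<phi>" "0 < a" "a < b" "b < 1" "\<forall>x. x \<le> a \<or> b \<le> x \<longrightarrow> \<phi> x = 0"
    by (rule test_functionsE[OF assms])
  have "D \<phi> x = 0" if "x < a \<or> b < x" for x
  proof -
    have "((\<lambda>_. 0) has_vector_derivative 0) (at x)" by simp
    then have "(\<phi> has_vector_derivative 0) (at x)"
      by (rule has_vector_derivative_transform_within_open[where S = "{..<a} \<union> {b<..}"])
         (use that ab(5) in auto)
    then show ?thesis
      by (simp add: D_def vector_derivative_at)
  qed
  then show ?thesis
    using ab smooth_D by (intro test_functionsI) auto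
qed

lemma test_functions_boundary:
  assumes "\<phi> \<in> test_functions"
  shows "x \<le> 0 \<Longrightarrow> \<phi> x = 0" "1 \<le> x \<Longrightarrow> \<phi> x = 0"
  using assms by (auto elim!: test_functionsE)

lemma test_functions_continuous: "\<phi> \<in> test_functions \<Longrightarrow> continuous_on A \<phi>"
  by (simp add: test_functions_iff smooth_continuous)

lemma continuous_on_imp_L2:
  assumes "continuous_on {0..1} f"
  shows "f \<in> L2"
proof -
  obtain B where "\<And>x. x \<in> {0..1} \<Longrightarrow> cmod (f x) \<le> B"
    using compact_imp_bounded[OF compact_continuous_image[OF assms]] unfolding bounded_iff by blast
  moreover have "f \<in> borel_measurable unit_interval_measure"
    using assms by (intro continuous_imp_measurable_on_sets_lebesgue)
      (auto intro: continuous_on_subset)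
  ultimately show ?thesis
    by (intro L2_bounded[where B = B]) auto
qed

lemma test_functions_L2: "\<phi> \<in> test_functions \<Longrightarrow> \<phi> \<in> L2"
  by (intro continuous_on_imp_L2 test_functions_continuous)

text \<open>The range of integration is encoded in the integrand, so that all integrals are over one
  fixed measure. Dominated convergence and Fubini then apply directly, and the cut-off may be any
  real number.\<close>

definition lower :: "(real \<Rightarrow> complex) \<Rightarrow> real \<Rightarrow> complex" where
  "lower g y = (LINT x|unit_interval_measure. (if x < y then g x else 0))"

definition upper :: "(real \<Rightarrow> complex) \<Rightarrow> real \<Rightarrow> complex" where
  "upper g x = (LINT y|unit_interval_measure. (if x < y then g y else 0))"

lemma L2_if:
  assumes "g \<in> L2" "A \<in> sets borel"
  shows "(\<lambda>x. if x \<in> A then g x else 0) \<in> L2"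
proof -
  have [measurable]: "(\<lambda>x. if x \<in> A then g x else 0) \<in> borel_measurable unit_interval_measure"
    using assms by (intro measurable_If_set L2_measurable) (auto simp: sets_unit_iff)
  have "integrable unit_interval_measure (\<lambda>x. (cmod (if x \<in> A then g x else 0))\<^sup>2)"
    by (rule Bochner_Integration.integrable_bound[OF L2_integrable_square[OF assms(1)]]) auto
  then show ?thesis by (simp add: L2_def)
qed

lemma L2_if_less:
  assumes "g \<in> L2"
  shows "(\<lambda>x. if x < y then g x else 0) \<in> L2" "(\<lambda>x. if y < x then g x else 0) \<in> L2"
  using L2_if[OF assms, of "{..<y}"] L2_if[OF assms, of "{y<..}"] by auto

lemma AE_unit_neq: "AE x in unit_interval_measure. x \<noteq> y"
proof -
  have "{y} \<in> null_sets lebesgue"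
    by simp
  then have "AE x in lebesgue. x \<noteq> y"
    using AE_not_in by fastforce
  then show ?thesis
    by (subst AE_restrict_space_iff) auto
qed

text \<open>The two strict cut-offs together miss only the point \<open>y\<close>, a null
  set.\<close>

lemma lower_add_upper:
  assumes "g \<in> L2"
  shows "lower g y + upper g y = (LINT x|unit_interval_measure. g x)"
proof -
  note [measurable] = L2_measurable[OF assms] L2_if_less[OF assms, THEN L2_measurable]
  have "lower g y + upper g y =
      (LINT x|unit_interval_measure. (if x < y then g x else 0) + (if y < x then g x else 0))"
    unfolding lower_def upper_def
    using L2_if_less[OF assms] by (intro Bochner_Integration.integral_add[symmetric]) auto
  also have "\<dots> = (LINT x|unit_interval_measure. g x)"
  proof (rule integral_cong_AE)
    show "AE x in unit_interval_measure.
        (if x < y then g x else 0) + (if y < x then g x else 0) = g x"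
      using AE_unit_neq[of y] by eventually_elim auto
  qed measurable
  finally show ?thesis .
qed

lemma lower_D_test_function:
  assumes "\<phi> \<in> test_functions" "y \<in> {0..1}"
  shows "lower (D \<phi>) y = \<phi> y"
proof -
  let ?f = "\<lambda>x. if x < y then D \<phi> x else 0"
  have sm: "smooth \<phi>"
    using assms(1) by (simp add: test_functions_iff)
  have L2: "?f \<in> L2"
    by (intro L2_if_less test_functions_L2 test_functions_D assms)
  then have "(?f has_integral lower (D \<phi>) y) {0<..<1}"
    unfolding lower_def by (intro has_integral_integral_lebesgue_on L2_integrable) auto
  then have "((\<lambda>x. if x \<in> {0<..<1} then ?f x else 0) has_integral lower (D \<phi>) y) UNIV"
    by (simp only: has_integral_restrict_UNIV)
  moreover have "(D \<phi> has_integral (\<phi> y - \<phi> 0)) {0..y}"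
    using assms(2) by (intro fundamental_theorem_of_calculus)
      (auto intro: has_vector_derivative_at_within smooth_has_vector_derivative[OF sm])
  then have "((\<lambda>x. if x \<in> {0..y} then D \<phi> x else 0) has_integral (\<phi> y - \<phi> 0)) UNIV"
    by (simp only: has_integral_restrict_UNIV)
  \<comment> \<open>The cut-off integrands on \<open>{0<..<1}\<close> and on \<open>{0..y}\<close>
    differ at most at 0, 1 and \<open>y\<close>.\<close>
  then have "((\<lambda>x. if x \<in> {0<..<1} then ?f x else 0) has_integral (\<phi> y - \<phi> 0)) UNIV"
    by (rule has_integral_spike[where S = "{0, 1, y}", rotated 2]) (use assms(2) in auto)
  ultimately have "lower (D \<phi>) y = \<phi> y - \<phi> 0"
    by (rule has_integral_unique)
  with test_functions_boundary(1)[OF assms(1), of 0] show ?thesis by simp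
qed

lemma lower_1: "lower g 1 = (LINT x|unit_interval_measure. g x)"
  unfolding lower_def by (intro Bochner_Integration.integral_cong) auto

lemma upper_0: "upper g 0 = (LINT x|unit_interval_measure. g x)"
  unfolding upper_def by (intro Bochner_Integration.integral_cong) auto

lemma upper_1: "upper g 1 = 0"
  unfolding upper_def by (intro integral_eq_zero_AE) auto

lemma integral_D_test_function:
  "\<phi> \<in> test_functions \<Longrightarrow> (LINT x|unit_interval_measure. D \<phi> x) = 0"
  using lower_D_test_function[of \<phi> 1] test_functions_boundary(2)[of \<phi> 1] by (simp add: lower_1)

lemma upper_D_test_function:
  assumes "\<phi> \<in> test_functions" "y \<in> {0..1}"
  shows "upper (D \<phi>) y = - \<phi> y"
  using lower_add_upper[OF test_functions_L2[OF test_functions_D[OF assms(1)]], of y]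
    lower_D_test_function[OF assms] integral_D_test_function[OF assms(1)]
  by (simp add: add_eq_0_iff)

text \<open>The integral from 0 is a smooth primitive that vanishes to the left of the support of
  \<open>\<eta>\<close>; mean zero is exactly what makes it vanish to the right as well.\<close>

lemma test_function_primitive:
  assumes "\<eta> \<in> test_functions" "(LINT x|unit_interval_measure. \<eta> x) = 0"
  obtains \<phi> where "\<phi> \<in> test_functions" "D \<phi> = \<eta>"
proof -
  obtain a b where ab: "smooth \<eta>" "0 < a" "a < b" "b < 1" "\<forall>x. x \<le> a \<or> b \<le> x \<longrightarrow> \<eta> x = 0"
    by (rule test_functionsE[OF assms(1)])
  define \<phi> where "\<phi> x = integral {0..x} \<eta>" for x
  have cont: "continuous_on A \<eta>" for A
    using ab(1) by (rule smooth_continuous)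
  have low: "\<phi> x = 0" if "x \<le> a" for x
  proof -
    have "\<phi> x = integral {0..x} (\<lambda>_. 0)"
      unfolding \<phi>_def using that ab by (intro Henstock_Kurzweil_Integration.integral_cong) auto
    then show ?thesis by simp
  qed
  have "(\<eta> has_integral (LINT x|unit_interval_measure. \<eta> x)) {0<..<1}"
    using assms by (intro has_integral_integral_lebesgue_on L2_integrable test_functions_L2) auto
  then have "integral {0..1} \<eta> = 0"
    using assms(2) has_integral_Icc_iff_Ioo integral_unique by metis
  have high: "\<phi> x = 0" if "b \<le> x" for x
  proof -
    have int: "\<eta> integrable_on {u..v}" for u v
      by (intro integrable_continuous_real cont)
    have *: "integral {b..z} \<eta> = 0" for z
    proof -
      have "integral {b..z} \<eta> = integral {b..z} (\<lambda>_. 0)"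
        using ab by (intro Henstock_Kurzweil_Integration.integral_cong) auto
      then show ?thesis by simp
    qed
    have "integral {0..b} \<eta> + integral {b..z} \<eta> = integral {0..z} \<eta>" if "b \<le> z" for z
      using that ab int by (intro Henstock_Kurzweil_Integration.integral_combine) auto
    \<comment> \<open>The instance 1 and the zero mean give integral 0 over \<open>{0..b}\<close>;
      the instance \<open>x\<close> transfers this to \<open>{0..x}\<close>.\<close>
    from this[of 1] this[of x] show ?thesis
      using * ab that \<open>integral {0..1} \<eta> = 0\<close> by (simp add: \<phi>_def)
  qed
  have der: "(\<phi> has_vector_derivative \<eta> x) (at x)" for x
  proof (cases "x < a")
    case True
    have "((\<lambda>_. 0) has_vector_derivative 0) (at x)" by simp
    then have "(\<phi> has_vector_derivative 0) (at x)"
      by (rule has_vector_derivative_transform_within_open[where S = "{..<a}"])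
         (use True low in auto)
    with True ab show ?thesis by simp
  next
    case False
    \<comment> \<open>As \<open>0 < a \<le> x\<close>, the point is interior to
      \<open>{0..x + 1}\<close>, which turns the derivative within this interval into a full
      one.\<close>
    then have "(\<phi> has_vector_derivative \<eta> x) (at x within {0..x + 1})"
      unfolding \<phi>_def using ab by (intro integral_has_vector_derivative cont) auto
    then show ?thesis
      using False ab by (subst (asm) at_within_interior) auto
  qed
  have "smooth \<phi>"
    by (rule smooth_coinduct[of \<phi> "{\<phi>}"]) (use ab(1) der in auto)
  then have "\<phi> \<in> test_functions"
    using ab low high by (intro test_functionsI[of \<phi> a b]) auto
  then show ?thesis
    using that D_eqI[of \<phi> \<eta>] der by blast
qed

section \<open>Density of the test functions\<close>

text \<open>Membership in the \<open>L2\<close> closure of the test functions, as a predicate that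
  can be propagated from intervals to Borel sets, Lebesgue sets, simple functions and finally all of
  \<open>L2\<close>. A non-integrable square gives norm 0 by default, so the predicate is meaningful
  only together with membership in \<open>L2\<close>.\<close>

definition approximable :: "(real \<Rightarrow> complex) \<Rightarrow> bool" where
  "approximable f \<longleftrightarrow> (\<forall>\<epsilon>>0. \<exists>\<phi>\<in>test_functions. L2_norm (\<lambda>x. f x - \<phi> x) < \<epsilon>)"

lemma L2_norm_cong: "(\<And>x. x \<in> {0<..<1} \<Longrightarrow> f x = g x) \<Longrightarrow> L2_norm f = L2_norm g"
  unfolding L2_norm_def by (intro arg_cong[where f = sqrt] Bochner_Integration.integral_cong) auto

lemma approximable_cong:
  assumes "\<And>x. x \<in> {0<..<1} \<Longrightarrow> f x = g x"
  shows "approximable f \<longleftrightarrow> approximable g"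
proof -
  have "L2_norm (\<lambda>x. f x - \<phi> x) = L2_norm (\<lambda>x. g x - \<phi> x)" for \<phi>
    using assms by (intro L2_norm_cong) auto
  then show ?thesis by (simp add: approximable_def)
qed

lemma approximable_add:
  assumes "f \<in> L2" "g \<in> L2" "approximable f" "approximable g"
  shows "approximable (\<lambda>x. f x + g x)"
  unfolding approximable_def
proof (intro allI impI)
  fix \<epsilon> :: real assume "\<epsilon> > 0"
  then obtain \<phi> \<psi> where *: "\<phi> \<in> test_functions" "L2_norm (\<lambda>x. f x - \<phi> x) < \<epsilon> / 2"
      "\<psi> \<in> test_functions" "L2_norm (\<lambda>x. g x - \<psi> x) < \<epsilon> / 2"
    using assms(3,4) unfolding approximable_def by (meson half_gt_zero)
  have "L2_norm (\<lambda>x. (f x - \<phi> x) + (g x - \<psi> x)) \<le> L2_norm (\<lambda>x. f x - \<phi> x) + L2_norm (\<lambda>x. g x - \<psi> x)"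
    by (intro L2_norm_triangle L2_diff assms * test_functions_L2)
  with * have "L2_norm (\<lambda>x. f x + g x - (\<phi> x + \<psi> x)) < \<epsilon>"
    by (simp add: algebra_simps)
  with * show "\<exists>\<phi>\<in>test_functions. L2_norm (\<lambda>x. f x + g x - \<phi> x) < \<epsilon>"
    by (intro bexI[of _ "\<lambda>x. \<phi> x + \<psi> x"] test_functions_add)
qed

lemma approximable_cmult:
  assumes "approximable f"
  shows "approximable (\<lambda>x. a * f x)"
  unfolding approximable_def
proof (intro allI impI)
  fix \<epsilon> :: real assume "\<epsilon> > 0"
  \<comment> \<open>The summand 1 covers the case \<open>a = 0\<close>.\<close>
  then have "\<epsilon> / (cmod a + 1) > 0"
    by (simp add: add_nonneg_pos)
  then obtain \<phi> where *: "\<phi> \<in> test_functions" "L2_norm (\<lambda>x. f x - \<phi> x) < \<epsilon> / (cmod a + 1)"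
    using assms unfolding approximable_def by blast
  have "L2_norm (\<lambda>x. a * f x - a * \<phi> x) = cmod a * L2_norm (\<lambda>x. f x - \<phi> x)"
    using L2_norm_cmult[of a "\<lambda>x. f x - \<phi> x"] by (simp add: right_diff_distrib)
  also have "\<dots> \<le> (cmod a + 1) * L2_norm (\<lambda>x. f x - \<phi> x)"
    by (intro mult_right_mono) auto
  also have "\<dots> < \<epsilon>"
    using *(2) by (simp add: field_simps add_pos_nonneg)
  finally show "\<exists>\<phi>\<in>test_functions. L2_norm (\<lambda>x. a * f x - \<phi> x) < \<epsilon>"
    using *(1) by (intro bexI[of _ "\<lambda>x. a * \<phi> x"] test_functions_cmult)
qed

lemma approximable_0: "approximable (\<lambda>_. 0)"
  unfolding approximable_def by (auto intro!: bexI[OF _ test_functions_0] simp: L2_norm_def)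

lemma approximable_sum:
  assumes "\<And>i. i \<in> A \<Longrightarrow> f i \<in> L2" "\<And>i. i \<in> A \<Longrightarrow> approximable (f i)"
  shows "approximable (\<lambda>x. \<Sum>i\<in>A. f i x)"
  using assms
proof (induction A rule: infinite_finite_induct)
  case (insert i A)
  then have "approximable (\<lambda>x. f i x + (\<Sum>i\<in>A. f i x))"
    by (intro approximable_add) auto
  with insert show ?case by simp
qed (auto intro: approximable_0)

text \<open>Dominated convergence for \<open>(cmod (f x - s n x))\<^sup>2\<close>, with majorant
  \<open>2 * (cmod (f x))\<^sup>2 + 2 * (B x)\<^sup>2\<close>. The bound is a function because the
  simple functions approximating an unbounded \<open>f\<close> are dominated only by a multiple of
  \<open>cmod (f x)\<close>.\<close>

lemma approximable_limit:
  assumes "f \<in> L2" "\<And>n. s n \<in> L2" "\<And>n. approximable (s n)"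
    and lim: "\<And>x. x \<in> {0<..<1} \<Longrightarrow> (\<lambda>n. s n x) \<longlonglongrightarrow> f x"
    and bound: "\<And>n x. x \<in> {0<..<1} \<Longrightarrow> cmod (s n x) \<le> B x"
    and B: "B \<in> borel_measurable unit_interval_measure" "integrable unit_interval_measure (\<lambda>x. (B x)\<^sup>2)"
  shows "approximable f"
  unfolding approximable_def
proof (intro allI impI)
  fix \<epsilon> :: real assume \<epsilon>: "\<epsilon> > 0"
  note [measurable] = assms(1,2)[THEN L2_measurable] B(1)
  have "(\<lambda>n. LINT x|unit_interval_measure. (cmod (f x - s n x))\<^sup>2) \<longlonglongrightarrow> (LINT x|unit_interval_measure. 0)"
  proof (rule integral_dominated_convergence)
    show "integrable unit_interval_measure (\<lambda>x. 2 * (cmod (f x))\<^sup>2 + 2 * (B x)\<^sup>2)"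
      by (intro Bochner_Integration.integrable_add integrable_mult_right L2_integrable_square assms)
    show "AE x in unit_interval_measure. (\<lambda>n. (cmod (f x - s n x))\<^sup>2) \<longlonglongrightarrow> 0"
    proof (intro AE_I2)
      fix x assume "x \<in> space unit_interval_measure"
      then have "(\<lambda>n. (cmod (f x - s n x))\<^sup>2) \<longlonglongrightarrow> (cmod (f x - f x))\<^sup>2"
        by (intro tendsto_intros lim) auto
      then show "(\<lambda>n. (cmod (f x - s n x))\<^sup>2) \<longlonglongrightarrow> 0" by simp
    qed
    fix n
    show "AE x in unit_interval_measure. norm ((cmod (f x - s n x))\<^sup>2) \<le> 2 * (cmod (f x))\<^sup>2 + 2 * (B x)\<^sup>2"
    proof (intro AE_I2)
      fix x assume x: "x \<in> space unit_interval_measure"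
      have "(cmod (f x - s n x))\<^sup>2 \<le> (cmod (f x) + B x)\<^sup>2"
        using norm_triangle_ineq4[of "f x" "s n x"] bound[of x n] x by (intro power_mono) auto
      also have "\<dots> \<le> 2 * (cmod (f x))\<^sup>2 + 2 * (B x)\<^sup>2"
        using sum_squares_bound[of "cmod (f x)" "B x"] by (simp add: power2_sum)
      finally show "norm ((cmod (f x - s n x))\<^sup>2) \<le> 2 * (cmod (f x))\<^sup>2 + 2 * (B x)\<^sup>2"
        by simp
    qed
  qed measurable
  then have "(\<lambda>n. L2_norm (\<lambda>x. f x - s n x)) \<longlonglongrightarrow> sqrt 0"
    unfolding L2_norm_def by (intro tendsto_real_sqrt) simp
  then have "\<forall>\<^sub>F n in sequentially. L2_norm (\<lambda>x. f x - s n x) < \<epsilon> / 2"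
    using \<epsilon> by (intro order_tendstoD) auto
  then obtain n where n: "L2_norm (\<lambda>x. f x - s n x) < \<epsilon> / 2"
    by (auto simp: eventually_sequentially)
  obtain \<phi> where *: "\<phi> \<in> test_functions" "L2_norm (\<lambda>x. s n x - \<phi> x) < \<epsilon> / 2"
    using assms(3)[of n] \<epsilon> unfolding approximable_def by (meson half_gt_zero)
  have "L2_norm (\<lambda>x. (f x - s n x) + (s n x - \<phi> x)) \<le> L2_norm (\<lambda>x. f x - s n x) + L2_norm (\<lambda>x. s n x - \<phi> x)"
    by (intro L2_norm_triangle L2_diff assms * test_functions_L2)
  with * n have "L2_norm (\<lambda>x. f x - \<phi> x) < \<epsilon>"
    by simp
  with * show "\<exists>\<phi>\<in>test_functions. L2_norm (\<lambda>x. f x - \<phi> x) < \<epsilon>"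
    by blast
qed

lemma approximable_bounded_limit:
  assumes "\<And>n. s n \<in> L2" "\<And>n. approximable (s n)"
    and lim: "\<And>x. x \<in> {0<..<1} \<Longrightarrow> (\<lambda>n. s n x) \<longlonglongrightarrow> f x"
    and bound: "\<And>n x. x \<in> {0<..<1} \<Longrightarrow> cmod (s n x) \<le> B"
  shows "approximable f"
proof (rule approximable_limit[where s = s and B = "\<lambda>_. B"])
  note [measurable] = assms(1)[THEN L2_measurable]
  have [measurable]: "f \<in> borel_measurable unit_interval_measure"
    by (rule borel_measurable_LIMSEQ_metric[where f = s]) (use lim in auto)
  have "cmod (f x) \<le> B" if "x \<in> {0<..<1}" for x
    using tendsto_norm[OF lim[OF that]] by (rule LIMSEQ_le_const2) (use bound that in auto)
  then show "f \<in> L2"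
    by (intro L2_bounded) auto
qed (use assms in \<open>auto intro: finite_measure.integrable_const\<close>)

lemma approximable_test_function: "\<phi> \<in> test_functions \<Longrightarrow> approximable \<phi>"
  unfolding approximable_def by (auto intro!: bexI[of _ \<phi>] simp: L2_norm_def)

section \<open>From indicator functions to all of \<open>L2\<close>\<close>

lemma L2_indicator:
  assumes "A \<in> sets lebesgue"
  shows "(\<lambda>x. indicator A x) \<in> L2"
proof (rule L2_bounded)
  have "indicator A \<in> borel_measurable lebesgue"
    using assms by simp
  then show "(\<lambda>x. indicator A x :: complex) \<in> borel_measurable unit_interval_measure"
    by (rule measurable_restrict_space1)
qed (auto simp: indicator_def)

lemma flat_1_tendsto:
  assumes "0 < c"
  shows "(\<lambda>n. flat 1 (real (Suc n) * c)) \<longlonglongrightarrow> 1"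
proof -
  have "(\<lambda>n. 1 / (real (Suc n) * c)) \<longlonglongrightarrow> 0"
    using tendsto_mult[OF LIMSEQ_inverse_real_of_nat tendsto_const[of "inverse c"]]
    by (simp add: divide_inverse)
  then have "(\<lambda>n. of_real (exp (- (1 / (real (Suc n) * c)))) :: complex) \<longlonglongrightarrow> of_real (exp (- 0))"
    by (intro tendsto_intros)
  moreover have "flat 1 (real (Suc n) * c) = of_real (exp (- (1 / (real (Suc n) * c))))" for n
    using assms by (simp only: flat_def) simp
  ultimately show ?thesis by simp
qed

text \<open>\<open>flat 1\<close> is a smooth step that tends to 1 at infinity. Two copies, rescaled
  by \<open>Suc n\<close>, one switching on at \<open>a\<close> and one switching off at
  \<open>b\<close>, have a product that is 0 outside the interval for every \<open>n\<close> and
  tends to 1 inside.\<close>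

lemma approximable_interval_compact:
  assumes "0 < a" "b < 1"
  shows "approximable (\<lambda>x. indicator {a<..<b} x)"
proof -
  \<comment> \<open>The arguments are expanded into the affine form of \<open>smooth_affine\<close>;
    \<open>s_eq\<close> is the factored form used for limits and signs.\<close>
  define s where "s n x = flat 1 (real (Suc n) * x + - real (Suc n) * a)
      * flat 1 (- real (Suc n) * x + real (Suc n) * b)" for n x
  have s_eq: "s n x = flat 1 (real (Suc n) * (x - a)) * flat 1 (real (Suc n) * (b - x))" for n x
    by (simp add: s_def algebra_simps)
  have smooth: "smooth (s n)" for n
    unfolding s_def by (intro smooth_mult smooth_affine smooth_flat)
  have s_0: "s n x = 0" if "x \<le> a \<or> b \<le> x" for n x
  proof -
    have "real (Suc n) * (x - a) \<le> 0 \<or> real (Suc n) * (b - x) \<le> 0"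
      using that by (auto simp: mult_le_0_iff)
    then show ?thesis
      unfolding s_eq flat_def by auto
  qed
  have test: "s n \<in> test_functions" for n
    using smooth s_0 assms by (intro test_functionsI[of _ a b]) auto
  show ?thesis
  proof (rule approximable_bounded_limit)
    show "s n \<in> L2" "approximable (s n)" for n
      using test by (auto intro: test_functions_L2 approximable_test_function)
    have "cmod (flat 1 x) \<le> 1" for x
      by (auto simp: flat_def)
    then show "cmod (s n x) \<le> 1" for n x
      unfolding s_def norm_mult by (intro mult_le_one) auto
    show "(\<lambda>n. s n x) \<longlonglongrightarrow> indicator {a<..<b} x" for x
    proof (cases "a < x \<and> x < b")
      case True
      then have "(\<lambda>n. s n x) \<longlonglongrightarrow> 1 * 1"
        unfolding s_eq by (intro tendsto_mult flat_1_tendsto) auto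
      with True show ?thesis by simp
    next
      case False
      then have "s n x = 0" for n
        using s_0 by auto
      with False show ?thesis by simp
    qed
  qed
qed

text \<open>Cutting margins \<open>d n\<close> off both ends of the unit interval reduces to the
  compact case; a fixed point of the open interval is eventually unaffected by the cut.\<close>

lemma approximable_interval: "approximable (\<lambda>x. indicator {a<..<b} x)"
proof (rule approximable_bounded_limit[where B = 1])
  define d where "d n = 1 / real (Suc n)" for n
  define s where "s n x = (indicator {max a (d n)<..<min b (1 - d n)} x :: complex)" for n x
  have pos: "0 < d n" for n
    by (simp add: d_def)
  show "s n \<in> L2" for n
    unfolding s_def by (rule L2_indicator) simp
  show "approximable (s n)" for n
    unfolding s_def using pos[of n] by (intro approximable_interval_compact) auto
  show "cmod (s n x) \<le> 1" for n x
    by (simp add: s_def indicator_def)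
  show "(\<lambda>n. s n x) \<longlonglongrightarrow> indicator {a<..<b} x" if "x \<in> {0<..<1}" for x
  proof -
    have d: "d \<longlonglongrightarrow> 0"
      using LIMSEQ_inverse_real_of_nat by (simp add: d_def[abs_def] divide_inverse)
    have "\<forall>\<^sub>F n in sequentially. d n < min x (1 - x)"
      using d by (rule order_tendstoD) (use that in auto)
    then have "\<forall>\<^sub>F n in sequentially. s n x = indicator {a<..<b} x"
      by eventually_elim (auto simp: s_def indicator_def)
    then show ?thesis by (rule tendsto_eventually)
  qed
qed

text \<open>Open intervals form an intersection-stable generator of the Borel sets, so Dynkin's
  theorem leaves complements and disjoint countable unions.\<close>

lemma approximable_borel:
  assumes "A \<in> sets borel"
  shows "approximable (\<lambda>x. indicator A x)"
proof -
  let ?G = "range (\<lambda>(a, b). {a<..<b::real})"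
  have borel: "(borel :: real measure) = sigma UNIV ?G"
  proof -
    have "(\<lambda>(a, b). box a (b::real)) = (\<lambda>(a, b). {a<..<b})"
      by auto
    then show ?thesis
      using borel_eq_box[where 'a = real] by simp
  qed
  have Int_stable: "Int_stable ?G"
  proof (rule Int_stableI)
    fix A B assume "A \<in> ?G" "B \<in> ?G"
    then obtain a b c d where "A = {a<..<b}" "B = {c<..<d}"
      by auto
    then have "A \<inter> B = {max a c<..<min b d}"
      by auto
    then show "A \<inter> B \<in> ?G"
      by (auto intro!: image_eqI[of _ _ "(max a c, min b d)"])
  qed
  have sets: "sets (borel :: real measure) = sigma_sets UNIV ?G"
    by (subst borel) (rule sets_measure_of, auto)
  have L2: "(\<lambda>x. indicator A x) \<in> L2" if "A \<in> sigma_sets UNIV ?G" for A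
    using that by (intro L2_indicator) (simp flip: sets)
  have Pow: "?G \<subseteq> Pow UNIV"
    by simp
  show ?thesis
    using Int_stable Pow assms[unfolded sets]
  proof (induction rule: sigma_sets_induct_disjoint)
    case (basic A)
    then show ?case using approximable_interval by auto
  next
    case empty
    then show ?case using approximable_0 by simp
  next
    case (compl A)
    \<comment> \<open>Only points of the unit interval matter, so the complement is taken relative
      to it.\<close>
    have "approximable (\<lambda>x. indicator {0<..<1} x + (-1) * indicator A x)"
      by (intro approximable_add approximable_cmult approximable_interval compl.IH L2_cmult L2 compl.hyps)
         (auto intro!: sigma_sets.Basic)
    then show ?case
      by (rule iffD1[OF approximable_cong, rotated]) (auto simp: indicator_def)
  next
    case (union A)
    show ?case
    proof (rule approximable_bounded_limit)
      show "(\<lambda>x. \<Sum>i<n. indicator (A i) x) \<in> L2" for n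
        using union by (intro L2_sum L2) auto
      show "approximable (\<lambda>x. \<Sum>i<n. indicator (A i) x)" for n
        using union by (intro approximable_sum L2) auto
      \<comment> \<open>Disjointness makes every partial sum an indicator function, hence bounded by
        1 uniformly in \<open>n\<close>.\<close>
      have eq: "(\<Sum>i<n. indicator (A i) x) = (indicator (\<Union>i<n. A i) x :: complex)" for n x
        using union by (intro indicator_UN_disjoint[symmetric]) (auto simp: disjoint_family_on_def)
      show "cmod (\<Sum>i<n. indicator (A i) x) \<le> 1" for n x
        unfolding eq by (simp add: indicator_def)
      show "(\<lambda>n. \<Sum>i<n. indicator (A i) x) \<longlonglongrightarrow> (indicator (\<Union>i. A i) x :: complex)" for x
        unfolding eq by (rule LIMSEQ_indicator_UN)
    qed
  qed
qed

lemma approximable_cong_AE: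
  assumes "AE x in unit_interval_measure. f x = g x" "f \<in> L2" "g \<in> L2" "approximable f"
  shows "approximable g"
proof -
  have "L2_norm (\<lambda>x. f x - \<phi> x) = L2_norm (\<lambda>x. g x - \<phi> x)" if "\<phi> \<in> test_functions" for \<phi>
  proof (rule L2_norm_cong_AE)
    show "AE x in unit_interval_measure. f x - \<phi> x = g x - \<phi> x"
      using assms(1) by eventually_elim simp
  qed (use assms that in \<open>auto intro!: L2_measurable L2_diff dest: test_functions_L2\<close>)
  with assms(4) show ?thesis
    by (auto simp: approximable_def)
qed

text \<open>A Lebesgue set differs from its Borel part only within a null set, which
  \<open>L2\<close> norms ignore.\<close>

lemma approximable_indicator:
  assumes "A \<in> sets lebesgue"
  shows "approximable (\<lambda>x. indicator A x)"
proof (rule approximable_cong_AE)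
  define B where "B = main_part lborel A"
  have B: "B \<in> sets borel"
    using main_part_sets[OF assms] by (simp add: B_def)
  show "approximable (\<lambda>x. indicator B x)"
    using B by (rule approximable_borel)
  show "(\<lambda>x. indicator B x) \<in> L2" "(\<lambda>x. indicator A x) \<in> L2"
    using B assms by (auto intro: L2_indicator)
  obtain N where N: "N \<in> null_sets lborel" "null_part lborel A \<subseteq> N"
    using null_part[OF assms] by blast
  have "AE x in lebesgue. x \<notin> N"
    using N(1) by (intro AE_not_in) (auto simp: null_sets_completionI)
  have A: "A = B \<union> null_part lborel A"
    using main_part_null_part_Un[OF assms] by (simp add: B_def)
  have "x \<in> A \<longleftrightarrow> x \<in> B" if "x \<notin> N" for x
    using A N(2) that by blast
  then have ind: "x \<in> {0<..<1} \<longrightarrow> (indicator B x :: complex) = indicator A x" if "x \<notin> N" for x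
    using that by (simp add: indicator_def)
  have "AE x in lebesgue. x \<in> {0<..<1} \<longrightarrow> (indicator B x :: complex) = indicator A x"
    using \<open>AE x in lebesgue. x \<notin> N\<close> by eventually_elim (rule ind)
  then show "AE x in unit_interval_measure. (indicator B x :: complex) = indicator A x"
    by (simp add: AE_restrict_space_iff)
qed

text \<open>Simple functions \<open>s i\<close> converge to \<open>f\<close> pointwise with
  \<open>cmod (s i x) \<le> 2 * cmod (f x)\<close>, and this majorant is square integrable.\<close>

lemma approximable_L2:
  assumes "f \<in> L2"
  shows "approximable f"
proof -
  obtain s where "\<forall>i. simple_function unit_interval_measure (s i)"
      "\<forall>x\<in>{0<..<1}. (\<lambda>i. s i x) \<longlonglongrightarrow> f x"
      "\<forall>i. \<forall>x\<in>{0<..<1}. cmod (s i x) \<le> 2 * cmod (f x)"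
    using borel_measurable_implies_sequence_metric[OF L2_measurable[OF assms], of 0]
    unfolding space_unit dist_complex_def diff_0_right by blast
  note s = this[rule_format]
  have "s i \<in> L2 \<and> approximable (s i)" for i
  proof -
    define A where "A y = s i -` {y} \<inter> {0<..<1}" for y
    have A: "A y \<in> sets lebesgue" for y
      using simple_functionD(2)[OF s(1), of i "{y}"] by (auto simp: A_def sets_unit_iff)
    \<comment> \<open>Nothing is known about \<open>s i\<close> outside the unit interval;
      \<open>t\<close> is a true combination of indicators that agrees with it inside.\<close>
    define t where "t x = (\<Sum>y\<in>s i ` {0<..<1}. y * indicator (A y) x)" for x
    have eq: "s i x = t x" if "x \<in> {0<..<1}" for x
    proof (rule trans[OF simple_function_indicator_representation_banach[OF s(1)]])
      show "(\<Sum>y\<in>s i ` space unit_interval_measure.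
          indicator (s i -` {y} \<inter> space unit_interval_measure) x *\<^sub>R y) = t x"
        unfolding t_def A_def space_unit by (intro sum.cong) (auto simp: indicator_def)
    qed (use that in simp)
    have "t \<in> L2"
      unfolding t_def by (intro L2_sum L2_cmult L2_indicator A)
    have "s i \<in> L2"
    proof (rule L2_cong_AE[OF \<open>t \<in> L2\<close>])
      show "AE x in unit_interval_measure. t x = s i x"
        using eq by (intro AE_I2) auto
      show "s i \<in> borel_measurable unit_interval_measure"
        using s(1) by (rule borel_measurable_simple_function)
    qed
    moreover have "approximable t"
      unfolding t_def by (intro approximable_sum approximable_cmult approximable_indicator L2_cmult L2_indicator A)
    ultimately show ?thesis
      using approximable_cong[of "s i" t] eq by auto
  qed
  moreover have "integrable unit_interval_measure (\<lambda>x. (2 * cmod (f x))\<^sup>2)"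
    using L2_integrable_square[OF assms] by (simp add: power_mult_distrib)
  ultimately show ?thesis
    using assms s(2,3) L2_measurable[OF assms]
    by (intro approximable_limit[of f s "\<lambda>x. 2 * cmod (f x)"]) auto
qed

theorem test_functions_dense_L2:
  assumes "f \<in> L2" "\<epsilon> > 0"
  obtains \<phi> where "\<phi> \<in> test_functions" "L2_norm (\<lambda>x. f x - \<phi> x) < \<epsilon>"
  using approximable_L2[OF assms(1)] assms(2) unfolding approximable_def by blast

section \<open>The Sobolev space and its boundary values\<close>

text \<open>If the norm of \<open>g\<close> were positive, \<open>cnj g\<close> could be
  approximated by a test function with an error below that norm. Pairing \<open>g\<close> with the
  error gives the squared norm, against Cauchy-Schwarz.\<close>

lemma L2_pairing_test_functions_eq_0:
  assumes "g \<in> L2" "\<And>\<phi>. \<phi> \<in> test_functions \<Longrightarrow> L2_pairing g \<phi> = 0"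
  shows "AE x in unit_interval_measure. g x = 0"
proof (rule L2_norm_0_imp_AE[OF assms(1)], rule ccontr)
  assume "L2_norm g \<noteq> 0"
  then have pos: "L2_norm g > 0"
    using L2_norm_nonneg[of g] by linarith
  obtain \<phi> where \<phi>: "\<phi> \<in> test_functions" "L2_norm (\<lambda>x. cnj (g x) - \<phi> x) < L2_norm g"
    using test_functions_dense_L2[OF L2_cnj[OF assms(1)] pos] .
  have "L2_pairing g (\<lambda>x. cnj (g x)) = complex_of_real ((L2_norm g)\<^sup>2)"
    unfolding L2_pairing_def L2_norm_square complex_norm_square[symmetric] by (rule integral_complex_of_real)
  then have "(L2_norm g)\<^sup>2 = cmod (L2_pairing g (\<lambda>x. cnj (g x)))"
    by (simp add: norm_power)
  also have "\<dots> = cmod (L2_pairing g (\<lambda>x. cnj (g x) - \<phi> x))"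
    using assms \<phi> by (simp add: L2_pairing_diff_right L2_cnj test_functions_L2)
  also have "\<dots> \<le> L2_norm g * L2_norm (\<lambda>x. cnj (g x) - \<phi> x)"
    by (intro L2_Cauchy_Schwarz L2_diff L2_cnj assms test_functions_L2 \<phi>)
  also have "\<dots> < (L2_norm g)\<^sup>2"
    using \<phi> pos by (simp add: power2_eq_square)
  finally show False by simp
qed

lemma L2_pairing_const: "L2_pairing (\<lambda>_. a) f = a * (LINT x|unit_interval_measure. f x)"
  by (simp add: L2_pairing_def)

lemma L2_norm_integral_le:
  assumes "f \<in> L2"
  shows "cmod (LINT x|unit_interval_measure. f x) \<le> L2_norm f"
  using L2_Cauchy_Schwarz[OF L2_const[of 1] assms] by (simp add: L2_pairing_const L2_norm_1)

text \<open>A test function at \<open>L2\<close> distance less than 1 from the constant 1 has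
  nonzero mean and can be rescaled.\<close>

lemma normalized_test_function:
  obtains \<rho> where "\<rho> \<in> test_functions" "(LINT x|unit_interval_measure. \<rho> x) = 1"
proof -
  obtain \<phi> where \<phi>: "\<phi> \<in> test_functions" "L2_norm (\<lambda>x. 1 - \<phi> x) < 1"
    using test_functions_dense_L2[OF L2_const[of 1] zero_less_one] .
  have "(LINT x|unit_interval_measure. 1 - \<phi> x) = 1 - (LINT x|unit_interval_measure. \<phi> x)"
    using L2_integrable[OF L2_const[of 1]] L2_integrable[OF test_functions_L2[OF \<phi>(1)]]
    by (subst Bochner_Integration.integral_diff) auto
  with L2_norm_integral_le[of "\<lambda>x. 1 - \<phi> x"] \<phi> have "(LINT x|unit_interval_measure. \<phi> x) \<noteq> 0"
    by (auto simp: L2_diff test_functions_L2)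
  then show ?thesis
    using that[of "\<lambda>x. inverse (LINT x|unit_interval_measure. \<phi> x) * \<phi> x"] \<phi>(1)
    by (auto intro: test_functions_cmult)
qed

text \<open>Subtracting from \<open>\<phi>\<close> its mean times \<open>\<rho>\<close> leaves the
  derivative of a test function. Hence \<open>v\<close> pairs with \<open>\<phi>\<close> as the
  constant \<open>L2_pairing v \<rho>\<close> does.\<close>

lemma du_Bois_Reymond:
  assumes "v \<in> L2" "\<And>\<phi>. \<phi> \<in> test_functions \<Longrightarrow> L2_pairing v (D \<phi>) = 0"
  obtains a where "AE x in unit_interval_measure. v x = a"
proof -
  obtain \<rho> where \<rho>: "\<rho> \<in> test_functions" "(LINT x|unit_interval_measure. \<rho> x) = 1"
    by (rule normalized_test_function)
  have "AE x in unit_interval_measure. v x - L2_pairing v \<rho> = 0"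
  proof (rule L2_pairing_test_functions_eq_0)
    fix \<phi> assume \<phi>: "\<phi> \<in> test_functions"
    define m where "m = (LINT x|unit_interval_measure. \<phi> x)"
    note L2 = test_functions_L2[OF \<phi>] test_functions_L2[OF \<rho>(1)]
    have "(LINT x|unit_interval_measure. \<phi> x - m * \<rho> x) = 0"
      using L2 \<rho>(2) by (subst Bochner_Integration.integral_diff) (auto simp: m_def)
    then obtain \<psi> where "\<psi> \<in> test_functions" "D \<psi> = (\<lambda>x. \<phi> x - m * \<rho> x)"
      using test_function_primitive[of "\<lambda>x. \<phi> x - m * \<rho> x"]
        test_functions_diff[OF \<phi> test_functions_cmult[OF \<rho>(1), of m]] by metis
    then have "L2_pairing v (\<lambda>x. \<phi> x - m * \<rho> x) = 0"
      using assms(2) by metis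
    then have "L2_pairing v \<phi> = m * L2_pairing v \<rho>"
      using assms(1) L2
      by (simp add: L2_pairing_diff_left L2_cmult L2_pairing_commute[of v] L2_pairing_cmult_left)
    then show "L2_pairing (\<lambda>x. v x - L2_pairing v \<rho>) \<phi> = 0"
      using assms(1) L2 by (simp add: L2_pairing_diff_left L2_pairing_const m_def)
  qed (use assms(1) in auto)
  then show ?thesis
    using that[of "L2_pairing v \<rho>"] by simp
qed

section \<open>Bounds, continuity and adjointness of \<open>upper\<close> and
  \<open>lower\<close>\<close>

lemma upper_le_L2_norm:
  assumes "g \<in> L2"
  shows "cmod (upper g x) \<le> L2_norm g"
proof -
  have "cmod (upper g x) \<le> (LINT y|unit_interval_measure. cmod (g y) * cmod 1)"
    unfolding upper_def
  proof (rule order_trans[OF integral_norm_bound integral_mono])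
    show "integrable unit_interval_measure (\<lambda>y. norm (if x < y then g y else 0))"
      using L2_if_less(2)[OF assms, of x] by auto
    show "integrable unit_interval_measure (\<lambda>y. cmod (g y) * cmod 1)"
      using assms by auto
  qed auto
  also have "\<dots> \<le> L2_norm g"
    using L2_Cauchy_Schwarz_norm[OF assms L2_const[of 1]] by (simp add: L2_norm_1)
  finally show ?thesis .
qed

text \<open>Along a sequence tending to \<open>x\<close> the cut-off integrands converge at every
  \<open>y \<noteq> x\<close>, dominated by \<open>cmod (g y)\<close>.\<close>

lemma upper_continuous:
  assumes "g \<in> L2"
  shows "continuous_on A (upper g)"
proof -
  note [measurable] = L2_measurable[OF assms] L2_if_less(2)[OF assms, THEN L2_measurable]
  have "(\<lambda>n. upper g (s n)) \<longlonglongrightarrow> upper g x" if s: "s \<longlonglongrightarrow> x" for s x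
    unfolding upper_def
  proof (rule integral_dominated_convergence)
    show "integrable unit_interval_measure (\<lambda>y. cmod (g y))"
      using assms by auto
    show "AE y in unit_interval_measure. (\<lambda>n. if s n < y then g y else 0) \<longlonglongrightarrow> (if x < y then g y else 0)"
      using AE_unit_neq[of x]
    proof eventually_elim
      case (elim y)
      have "\<forall>\<^sub>F n in sequentially. s n < y \<longleftrightarrow> x < y"
      proof (cases "x < y")
        case True
        with order_tendstoD(2)[OF s this] show ?thesis by simp
      next
        case False
        with elim have "y < x" by simp
        from order_tendstoD(1)[OF s this] show ?thesis
          by eventually_elim (use False in auto)
      qed
      then show ?case
        by (intro tendsto_eventually, eventually_elim) simp
    qed
  qed auto
  then show ?thesis
    by (intro continuous_at_imp_continuous_on ballI) (auto simp: continuous_at_sequentially o_def)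
qed

lemma upper_L2: "g \<in> L2 \<Longrightarrow> upper g \<in> L2"
  by (rule continuous_on_imp_L2[OF upper_continuous])

lemma lower_L2:
  assumes "g \<in> L2"
  shows "lower g \<in> L2"
proof -
  have "lower g = (\<lambda>x. (LINT x|unit_interval_measure. g x) - upper g x)"
    using lower_add_upper[OF assms] by (auto simp: algebra_simps)
  then show ?thesis
    using assms by (auto intro!: L2_diff upper_L2)
qed

text \<open>Both sides integrate \<open>f x * g y\<close> over the triangle \<open>x < y\<close>.
  This adjointness takes the place of integration by parts throughout.\<close>

lemma L2_pairing_upper:
  assumes "f \<in> L2" "g \<in> L2"
  shows "L2_pairing (upper g) f = L2_pairing g (lower f)"
proof -
  interpret M: finite_measure unit_interval_measure by simp
  interpret pair_sigma_finite unit_interval_measure unit_interval_measure ..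
  note [measurable] = assms[THEN L2_measurable]
  have id: "(\<lambda>x. x) \<in> borel_measurable unit_interval_measure"
    by (intro continuous_imp_measurable_on_sets_lebesgue) auto
  let ?N = "unit_interval_measure \<Otimes>\<^sub>M unit_interval_measure"
  let ?k = "\<lambda>x y. if x < y then f x * g y else 0"
  \<comment> \<open>Measurability of the two coordinates as real functions makes the triangle a
    measurable set of the product.\<close>
  have [measurable]: "fst \<in> borel_measurable ?N" "snd \<in> borel_measurable ?N"
    using measurable_compose[OF measurable_fst id] measurable_compose[OF measurable_snd id] by auto
  have prod_meas [measurable]: "(\<lambda>(x, y). f x * g y) \<in> borel_measurable ?N"
    by measurable
  have meas: "case_prod ?k \<in> borel_measurable ?N"
    unfolding split_beta by measurable
  have "integrable ?N (\<lambda>(x, y). f x * g y)"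
  proof (rule Fubini_integrable)
    show "integrable unit_interval_measure (\<lambda>x. LINT y|unit_interval_measure. norm (case (x, y) of (x, y) \<Rightarrow> f x * g y))"
      using assms by (auto simp: norm_mult)
  qed (use assms in auto)
  then have int: "integrable ?N (case_prod ?k)"
    by (rule Bochner_Integration.integrable_bound) (use meas in auto)
  have "L2_pairing (upper g) f = (LINT x|unit_interval_measure. LINT y|unit_interval_measure. ?k x y)"
    unfolding L2_pairing_def upper_def
  proof (intro Bochner_Integration.integral_cong refl)
    fix x
    have "(LINT y|unit_interval_measure. ?k x y)
        = (LINT y|unit_interval_measure. (if x < y then g y else 0) * f x)"
      by (intro Bochner_Integration.integral_cong) auto
    then show "(LINT y|unit_interval_measure. (if x < y then g y else 0)) * f x
        = (LINT y|unit_interval_measure. ?k x y)"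
      by simp
  qed
  also have "\<dots> = (LINT y|unit_interval_measure. LINT x|unit_interval_measure. ?k x y)"
    by (rule Fubini_integral[OF int, symmetric])
  also have "\<dots> = L2_pairing g (lower f)"
    unfolding L2_pairing_def lower_def
  proof (intro Bochner_Integration.integral_cong refl)
    fix y
    have "(LINT x|unit_interval_measure. ?k x y)
        = (LINT x|unit_interval_measure. g y * (if x < y then f x else 0))"
      by (intro Bochner_Integration.integral_cong) auto
    then show "(LINT x|unit_interval_measure. ?k x y)
        = g y * (LINT x|unit_interval_measure. (if x < y then f x else 0))"
      by simp
  qed
  finally show ?thesis .
qed

lemma L2_pairing_cong:
  assumes "\<And>x. x \<in> {0<..<1} \<Longrightarrow> f x = f' x" "\<And>x. x \<in> {0<..<1} \<Longrightarrow> g x = g' x"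
  shows "L2_pairing f g = L2_pairing f' g'"
  unfolding L2_pairing_def using assms by (intro Bochner_Integration.integral_cong) auto

lemma has_weak_derivative_cong:
  assumes "\<And>x. x \<in> {0<..<1} \<Longrightarrow> u x = v x"
  shows "has_weak_derivative u = has_weak_derivative v"
proof -
  have "L2_pairing u f = L2_pairing v f" for f
    using assms by (intro L2_pairing_cong) auto
  then show ?thesis by (simp add: fun_eq_iff has_weak_derivative_def)
qed

lemma has_weak_derivative_upper:
  assumes "g \<in> L2"
  shows "has_weak_derivative (upper g) (\<lambda>x. - g x)"
  unfolding has_weak_derivative_def
proof
  fix \<phi> assume \<phi>: "\<phi> \<in> test_functions"
  have "L2_pairing (upper g) (D \<phi>) = L2_pairing g (lower (D \<phi>))"
    by (intro L2_pairing_upper test_functions_L2 test_functions_D \<phi> assms)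
  also have "\<dots> = L2_pairing g \<phi>"
    using lower_D_test_function[OF \<phi>] by (intro L2_pairing_cong) auto
  also have "\<dots> = - L2_pairing (\<lambda>x. - g x) \<phi>"
    using L2_pairing_cmult_left[of "-1" g \<phi>] by simp
  finally show "L2_pairing (upper g) (D \<phi>) = - L2_pairing (\<lambda>x. - g x) \<phi>" .
qed

section \<open>The space \<open>H1\<close> and the choice of weak derivatives\<close>

lemma H1I:
  assumes "continuous_on {0..1} u" "g \<in> L2" "has_weak_derivative u g"
  shows "u \<in> H1"
  using assms continuous_on_imp_L2 by (auto simp: H1_def)

lemma H1_L2: "u \<in> H1 \<Longrightarrow> u \<in> L2"
  by (simp add: H1_def)

lemma H1_continuous: "u \<in> H1 \<Longrightarrow> continuous_on {0..1} u"
  by (simp add: H1_def)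

lemma
  assumes "u \<in> H1"
  shows weak_derivative_L2: "weak_derivative u \<in> L2"
    and has_weak_derivative_weak_derivative: "has_weak_derivative u (weak_derivative u)"
proof -
  have "\<exists>g. g \<in> L2 \<and> has_weak_derivative u g"
    using assms by (auto simp: H1_def)
  from someI_ex[OF this] show "weak_derivative u \<in> L2" "has_weak_derivative u (weak_derivative u)"
    by (auto simp: weak_derivative_def)
qed

lemma has_weak_derivative_add:
  assumes "u \<in> L2" "v \<in> L2" "f \<in> L2" "g \<in> L2" "has_weak_derivative u f" "has_weak_derivative v g"
  shows "has_weak_derivative (\<lambda>x. u x + v x) (\<lambda>x. f x + g x)"
  using assms by (simp add: has_weak_derivative_def L2_pairing_add_left test_functions_L2 test_functions_D)

lemma has_weak_derivative_cmult:
  assumes "has_weak_derivative u f"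
  shows "has_weak_derivative (\<lambda>x. a * u x) (\<lambda>x. a * f x)"
  using assms by (simp add: has_weak_derivative_def L2_pairing_cmult_left)

lemma has_weak_derivative_const: "has_weak_derivative (\<lambda>_. a) (\<lambda>_. 0)"
  by (simp add: has_weak_derivative_def L2_pairing_const integral_D_test_function)

lemma has_weak_derivative_unique:
  assumes "f \<in> L2" "g \<in> L2" "has_weak_derivative u f" "has_weak_derivative u g"
  shows "AE x in unit_interval_measure. f x = g x"
proof -
  have "AE x in unit_interval_measure. f x - g x = 0"
  proof (rule L2_pairing_test_functions_eq_0)
    fix \<phi> assume "\<phi> \<in> test_functions"
    then show "L2_pairing (\<lambda>x. f x - g x) \<phi> = 0"
      using assms unfolding has_weak_derivative_def
      by (simp add: L2_pairing_diff_left test_functions_L2)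
  qed (use assms in auto)
  then show ?thesis by simp
qed

lemma weak_derivative_eq_AE:
  assumes "u \<in> H1" "g \<in> L2" "has_weak_derivative u g"
  shows "AE x in unit_interval_measure. weak_derivative u x = g x"
  by (rule has_weak_derivative_unique[OF weak_derivative_L2 assms(2) has_weak_derivative_weak_derivative])
     (fact assms)+

text \<open>Frees later computations from the choice in \<open>weak_derivative\<close>: inside a
  pairing any known weak derivative may replace it.\<close>

lemma L2_pairing_weak_derivative:
  assumes "u \<in> H1" "g \<in> L2" "has_weak_derivative u g" "f \<in> L2"
  shows "L2_pairing f (weak_derivative u) = L2_pairing f g"
  unfolding L2_pairing_commute[of f]
  using assms by (intro L2_pairing_cong_AE weak_derivative_eq_AE L2_measurable weak_derivative_L2)

lemma L2_norm_weak_derivative: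
  assumes "u \<in> H1" "g \<in> L2" "has_weak_derivative u g"
  shows "L2_norm (weak_derivative u) = L2_norm g"
  using assms by (intro L2_norm_cong_AE weak_derivative_eq_AE L2_measurable weak_derivative_L2)

lemma H1_add:
  assumes "u \<in> H1" "v \<in> H1"
  shows "(\<lambda>x. u x + v x) \<in> H1"
  by (rule H1I[where g = "\<lambda>x. weak_derivative u x + weak_derivative v x"])
     (intro assms continuous_on_add H1_continuous L2_add weak_derivative_L2 has_weak_derivative_add
       H1_L2 has_weak_derivative_weak_derivative)+

lemma H1_cmult:
  assumes "u \<in> H1"
  shows "(\<lambda>x. a * u x) \<in> H1"
  by (rule H1I[where g = "\<lambda>x. a * weak_derivative u x"])
     (intro assms continuous_on_mult continuous_on_const H1_continuous L2_cmult weak_derivative_L2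
       has_weak_derivative_cmult has_weak_derivative_weak_derivative)+

lemma H1_diff: "u \<in> H1 \<Longrightarrow> v \<in> H1 \<Longrightarrow> (\<lambda>x. u x - v x) \<in> H1"
  using H1_add[of u "\<lambda>x. -1 * v x"] H1_cmult[of v "-1"] by simp

lemma H1_const: "(\<lambda>_. a) \<in> H1"
  by (rule H1I[OF _ _ has_weak_derivative_const]) auto

lemma H1_cong:
  assumes "u \<in> H1" "\<And>x. x \<in> {0..1} \<Longrightarrow> u x = v x"
  shows "v \<in> H1"
proof (rule H1I)
  show "continuous_on {0..1} v"
    using H1_continuous[OF assms(1)] assms(2) by (rule continuous_on_cong[THEN iffD1, OF refl, rotated]) auto
  show "has_weak_derivative v (weak_derivative u)"
    using has_weak_derivative_weak_derivative[OF assms(1)] assms(2)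
    by (subst has_weak_derivative_cong[of v u]) auto
qed (intro weak_derivative_L2 assms)

lemma H1_upper: "g \<in> L2 \<Longrightarrow> upper g \<in> H1"
  by (rule H1I[OF _ _ has_weak_derivative_upper]) (auto intro: upper_continuous)

lemma L2_pairing_weak_derivative_add:
  assumes "u \<in> H1" "v \<in> H1" "f \<in> L2"
  shows "L2_pairing f (weak_derivative (\<lambda>x. u x + v x))
    = L2_pairing f (weak_derivative u) + L2_pairing f (weak_derivative v)"
proof -
  have "L2_pairing f (weak_derivative (\<lambda>x. u x + v x)) = L2_pairing f (\<lambda>x. weak_derivative u x + weak_derivative v x)"
    by (intro assms L2_pairing_weak_derivative H1_add has_weak_derivative_add L2_add
        H1_L2[OF assms(1)] H1_L2[OF assms(2)] weak_derivative_L2 has_weak_derivative_weak_derivative)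
  then show ?thesis
    using assms by (simp add: L2_pairing_commute[of f] L2_pairing_add_left weak_derivative_L2)
qed

lemma L2_pairing_weak_derivative_cmult:
  assumes "u \<in> H1" "f \<in> L2"
  shows "L2_pairing f (weak_derivative (\<lambda>x. a * u x)) = a * L2_pairing f (weak_derivative u)"
proof -
  have "L2_pairing f (weak_derivative (\<lambda>x. a * u x)) = L2_pairing f (\<lambda>x. a * weak_derivative u x)"
    using assms by (intro L2_pairing_weak_derivative H1_cmult has_weak_derivative_cmult L2_cmult
        weak_derivative_L2 has_weak_derivative_weak_derivative)
  then show ?thesis
    by (simp add: L2_pairing_commute[of f] L2_pairing_cmult_left)
qed

text \<open>The set where \<open>v\<close> equals \<open>a\<close> is dense, since a nonempty open
  set is not negligible; continuity extends the equation up to the end points.\<close>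

lemma AE_eq_const_continuous:
  assumes "AE x in unit_interval_measure. v x = a" "continuous_on {0..1} v" "x \<in> {0..1::real}"
  shows "v x = (a :: complex)"
proof -
  define S where "S = {x \<in> {0<..<1}. v x = a}"
  have "AE x in lebesgue. x \<in> {0<..<1} \<longrightarrow> v x = a"
    using assms(1) by (simp add: AE_restrict_space_iff)
  then obtain N where N: "\<And>x. x \<in> space lebesgue - N \<Longrightarrow> x \<in> {0<..<1} \<longrightarrow> v x = a" "N \<in> null_sets lebesgue"
    by (rule AE_E3) blast
  have "{0<..<1} - closure S \<subseteq> N"
    using N(1) closure_subset[of S] by (auto simp: S_def)
  then have "negligible ({0<..<1} - closure S)"
    using N(2) negligible_subset by (auto simp: negligible_iff_null_sets)
  moreover have "open ({0<..<1} - closure S)"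
    by (intro open_Diff) auto
  ultimately have "{0<..<1} \<subseteq> closure S"
    using open_not_negligible by blast
  then have "closure {0<..<1} \<subseteq> closure S"
    by (rule closure_minimal) simp
  then have "x \<in> closure S"
    using assms(3) by auto
  moreover have "closure S \<subseteq> {0..1}"
    by (rule closure_minimal) (auto simp: S_def)
  then have "continuous_on (closure S) v"
    using assms(2) continuous_on_subset by blast
  ultimately show ?thesis
    by (intro continuous_constant_on_closure[of S v a x]) (auto simp: S_def)
qed

text \<open>The sum of \<open>u\<close> and \<open>upper (weak_derivative u)\<close> has weak
  derivative 0, so it is constant; evaluation at 1, where \<open>upper\<close> vanishes, identifies
  the constant.\<close>

lemma H1_eq_upper:
  assumes "u \<in> H1" "x \<in> {0..1}"
  shows "u x = u 1 - upper (weak_derivative u) x"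
proof -
  let ?g = "weak_derivative u"
  let ?v = "\<lambda>x. u x + upper ?g x"
  note g = weak_derivative_L2[OF assms(1)]
  have wd: "has_weak_derivative ?v (\<lambda>x. ?g x + - ?g x)"
    by (intro assms g has_weak_derivative_add has_weak_derivative_weak_derivative
        has_weak_derivative_upper H1_L2[OF assms(1)] upper_L2 L2_uminus)
  have L2: "?v \<in> L2"
    using assms(1) g by (auto intro: H1_L2 upper_L2)
  obtain a where a: "AE x in unit_interval_measure. ?v x = a"
  proof (rule du_Bois_Reymond[OF L2])
    fix \<phi> assume "\<phi> \<in> test_functions"
    with wd show "L2_pairing ?v (D \<phi>) = 0"
      by (simp add: has_weak_derivative_def L2_pairing_const)
  qed
  have "?v y = a" if "y \<in> {0..1}" for y
    using that assms(1) g
    by (intro AE_eq_const_continuous[OF a] continuous_on_add H1_continuous upper_continuous)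
  from this[OF assms(2)] this[of 1] show ?thesis
    by (simp add: upper_1 algebra_simps)
qed

lemma integral_weak_derivative:
  assumes "u \<in> H1"
  shows "(LINT x|unit_interval_measure. weak_derivative u x) = u 1 - u 0"
  using H1_eq_upper[OF assms, of 0] by (simp add: upper_0)

lemma has_weak_derivative_test_function:
  assumes "\<phi> \<in> test_functions"
  shows "has_weak_derivative \<phi> (D \<phi>)"
proof -
  have "has_weak_derivative (\<lambda>x. -1 * upper (D \<phi>) x) (\<lambda>x. -1 * - D \<phi> x)"
    using assms by (intro has_weak_derivative_cmult has_weak_derivative_upper test_functions_L2 test_functions_D)
  moreover have "has_weak_derivative (\<lambda>x. -1 * upper (D \<phi>) x) = has_weak_derivative \<phi>"
    using upper_D_test_function[OF assms] by (intro has_weak_derivative_cong) auto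
  ultimately show ?thesis by simp
qed

lemma test_functions_H1: "\<phi> \<in> test_functions \<Longrightarrow> \<phi> \<in> H1"
  by (rule H1I[where g = "D \<phi>"])
     (intro test_functions_continuous test_functions_L2 test_functions_D
       has_weak_derivative_test_function; assumption)+

section \<open>Norm estimates and boundary values\<close>

lemma H1_norm_nonneg: "0 \<le> H1_norm u"
  by (simp add: H1_norm_def)

lemma L2_norm_le_H1_norm: "L2_norm u \<le> H1_norm u"
  and L2_norm_weak_derivative_le_H1_norm: "L2_norm (weak_derivative u) \<le> H1_norm u"
  by (auto simp: H1_norm_def intro!: real_le_rsqrt)

lemma H1_norm_le: "H1_norm u \<le> L2_norm u + L2_norm (weak_derivative u)"
  unfolding H1_norm_def by (rule sqrt_sum_squares_le_sum) auto

lemma H1_norm_cong: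
  assumes "\<And>x. x \<in> {0<..<1} \<Longrightarrow> u x = v x"
  shows "H1_norm u = H1_norm v"
  using L2_norm_cong[OF assms] has_weak_derivative_cong[OF assms]
  by (simp add: H1_norm_def weak_derivative_def)

text \<open>One copy of \<open>L2_norm g\<close> bounds \<open>upper g\<close> itself through its
  uniform bound, the other is the norm of its derivative \<open>- g\<close>.\<close>

lemma H1_norm_upper_le:
  assumes "g \<in> L2"
  shows "H1_norm (upper g) \<le> 2 * L2_norm g"
proof -
  have "L2_norm (weak_derivative (upper g)) = L2_norm (\<lambda>x. - g x)"
    using assms by (intro L2_norm_weak_derivative H1_upper L2_uminus has_weak_derivative_upper)
  also have "\<dots> = L2_norm g"
    by (simp add: L2_norm_def)
  finally show ?thesis
    using H1_norm_le[of "upper g"] L2_norm_le_bound[OF upper_L2[OF assms] upper_le_L2_norm[OF assms]]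
    by simp
qed

text \<open>The constant \<open>v 1\<close> equals \<open>v + upper (weak_derivative v)\<close>, and
  on an interval of length 1 its modulus is its \<open>L2\<close> norm. Two norms are spent at 1;
  passing to 0 costs a third.\<close>

lemma boundary_le_H1_norm:
  assumes "v \<in> H1"
  shows "cmod (v 1) \<le> 2 * H1_norm v" "cmod (v 0) \<le> 3 * H1_norm v"
proof -
  let ?g = "weak_derivative v"
  note g = weak_derivative_L2[OF assms]
  have "cmod (v 1) = L2_norm (\<lambda>x. v 1)"
    by (simp add: L2_norm_def)
  also have "\<dots> = L2_norm (\<lambda>x. v x + upper ?g x)"
    using H1_eq_upper[OF assms] by (intro L2_norm_cong) (auto simp: algebra_simps)
  also have "\<dots> \<le> L2_norm v + L2_norm (upper ?g)"
    by (intro L2_norm_triangle H1_L2 upper_L2 assms g)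
  also have "L2_norm (upper ?g) \<le> L2_norm ?g"
    by (intro L2_norm_le_bound upper_L2 g upper_le_L2_norm L2_norm_nonneg)
  finally show *: "cmod (v 1) \<le> 2 * H1_norm v"
    using L2_norm_le_H1_norm[of v] L2_norm_weak_derivative_le_H1_norm[of v] by linarith
  have "cmod (v 0) \<le> cmod (v 1) + cmod (upper ?g 0)"
    using H1_eq_upper[OF assms, of 0] norm_triangle_ineq4[of "v 1" "upper ?g 0"] by simp
  also have "cmod (upper ?g 0) \<le> L2_norm ?g"
    using g by (rule upper_le_L2_norm)
  finally show "cmod (v 0) \<le> 3 * H1_norm v"
    using * L2_norm_weak_derivative_le_H1_norm[of v] by linarith
qed

text \<open>Boundary values are bounded by the \<open>H1\<close> norm, so they remain 0 in the
  closure. Conversely, a derivative of mean zero is approximated by test functions of mean zero,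
  whose primitives are test functions near \<open>v\<close>.\<close>

lemma H1_0_iff: "v \<in> H1_0 \<longleftrightarrow> v \<in> H1 \<and> v 0 = 0 \<and> v 1 = 0"
proof
  assume v: "v \<in> H1_0"
  then have H1: "v \<in> H1" by (simp add: H1_0_def)
  have "cmod (v 0) \<le> 0 + e \<and> cmod (v 1) \<le> 0 + e" if "e > 0" for e
  proof -
    \<comment> \<open>The divisor 3 compensates the larger constant in
      \<open>boundary_le_H1_norm\<close>.\<close>
    have "\<exists>\<phi>\<in>test_functions. H1_norm (\<lambda>x. v x - \<phi> x) < e / 3"
      using v divide_pos_pos[OF that, of 3] unfolding H1_0_def mem_Collect_eq by (metis zero_less_numeral)
    then obtain \<phi> where \<phi>: "\<phi> \<in> test_functions" "H1_norm (\<lambda>x. v x - \<phi> x) < e / 3"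
      by blast
    have "\<phi> 0 = 0" "\<phi> 1 = 0"
      using test_functions_boundary[OF \<phi>(1)] by auto
    moreover have "(\<lambda>x. v x - \<phi> x) \<in> H1"
      using H1 test_functions_H1[OF \<phi>(1)] by (rule H1_diff)
    ultimately show ?thesis
      using boundary_le_H1_norm[of "\<lambda>x. v x - \<phi> x"] \<phi>(2) \<open>e > 0\<close> by simp
  qed
  then have "cmod (v 0) \<le> 0" "cmod (v 1) \<le> 0"
    by (blast intro: field_le_epsilon)+
  with H1 show "v \<in> H1 \<and> v 0 = 0 \<and> v 1 = 0" by simp
next
  assume v: "v \<in> H1 \<and> v 0 = 0 \<and> v 1 = 0"
  define g where "g = weak_derivative v"
  have g: "g \<in> L2" "(LINT x|unit_interval_measure. g x) = 0"
    using v by (auto simp: g_def weak_derivative_L2 integral_weak_derivative)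
  obtain \<rho> where \<rho>: "\<rho> \<in> test_functions" "(LINT x|unit_interval_measure. \<rho> x) = 1"
    by (rule normalized_test_function)
  have "\<exists>\<phi>\<in>test_functions. H1_norm (\<lambda>x. v x - \<phi> x) < \<epsilon>" if "\<epsilon> > 0" for \<epsilon>
  proof -
    \<comment> \<open>The error is \<open>e\<close> for approximating \<open>g\<close> plus at most
      \<open>e * L2_norm \<rho>\<close> for correcting the mean, hence \<open>e * s\<close>; the
      factor 2 is that of \<open>H1_norm_upper_le\<close>.\<close>
    define s where "s = 1 + L2_norm \<rho>"
    define e where "e = \<epsilon> / (2 * s)"
    have "0 < s"
      using L2_norm_nonneg[of \<rho>] unfolding s_def by linarith
    then have e: "0 < e" "2 * (e * s) = \<epsilon>"
      using \<open>\<epsilon> > 0\<close> by (auto simp: e_def)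
    obtain \<eta> where \<eta>: "\<eta> \<in> test_functions" "L2_norm (\<lambda>x. g x - \<eta> x) < e"
      using test_functions_dense_L2[OF g(1) e(1)] .
    \<comment> \<open>As \<open>g\<close> has mean zero, \<open>m\<close> is minus the mean of
      \<open>\<eta>\<close>: adding \<open>m * \<rho>\<close> restores mean zero, and the size of
      \<open>m\<close> is controlled by the approximation error.\<close>
    define m where "m = (LINT x|unit_interval_measure. g x - \<eta> x)"
    have m: "m = - (LINT x|unit_interval_measure. \<eta> x)" "cmod m \<le> e"
      using L2_norm_integral_le[of "\<lambda>x. g x - \<eta> x"] g \<eta>
      by (auto simp: m_def L2_diff test_functions_L2 L2_integrable)
    define \<eta>' where "\<eta>' x = \<eta> x + m * \<rho> x" for x
    have \<eta>': "\<eta>' \<in> test_functions"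
      unfolding \<eta>'_def by (intro test_functions_add test_functions_cmult \<eta> \<rho>)
    moreover have "(LINT x|unit_interval_measure. \<eta>' x) = 0"
      unfolding \<eta>'_def using \<eta> \<rho> m(1)
      by (simp add: L2_integrable test_functions_L2)
    ultimately obtain \<phi> where \<phi>: "\<phi> \<in> test_functions" "D \<phi> = \<eta>'"
      by (rule test_function_primitive)
    define k where "k x = g x - \<eta>' x" for x
    have k: "k \<in> L2"
      unfolding k_def using g(1) test_functions_L2[OF \<eta>'] by (rule L2_diff)
    have "L2_norm k = L2_norm (\<lambda>x. (g x - \<eta> x) + (- m) * \<rho> x)"
      by (simp add: k_def[abs_def] \<eta>'_def algebra_simps)
    also have "\<dots> \<le> L2_norm (\<lambda>x. g x - \<eta> x) + L2_norm (\<lambda>x. (- m) * \<rho> x)"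
      by (intro L2_norm_triangle L2_diff L2_cmult g test_functions_L2[OF \<eta>(1)] test_functions_L2[OF \<rho>(1)])
    also have "L2_norm (\<lambda>x. (- m) * \<rho> x) \<le> e * L2_norm \<rho>"
      using m(2) unfolding L2_norm_cmult by (intro mult_right_mono) auto
    finally have k_less: "2 * L2_norm k < \<epsilon>"
      using \<eta>(2) e by (simp add: s_def algebra_simps)
    have upper_k: "v x - \<phi> x = (-1) * upper k x" if "x \<in> {0<..<1}" for x
    proof -
      have "v x = - upper g x"
        using H1_eq_upper[of v x] v that by (simp add: g_def)
      moreover have "\<phi> x = - upper \<eta>' x"
        using upper_D_test_function[OF \<phi>(1), of x] \<phi>(2) that by simp
      moreover have "upper k x = upper g x - upper \<eta>' x"
        using L2_if_less(2)[OF g(1), of x] L2_if_less(2)[OF test_functions_L2[OF \<eta>'], of x]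
        unfolding upper_def k_def
        by (subst Bochner_Integration.integral_diff[symmetric]) (auto intro!: Bochner_Integration.integral_cong)
      ultimately show ?thesis by simp
    qed
    have "H1_norm (\<lambda>x. v x - \<phi> x) = H1_norm (\<lambda>x. (-1) * upper k x)"
      using upper_k by (rule H1_norm_cong)
    also have "\<dots> = H1_norm (upper (\<lambda>x. (-1) * k x))"
      unfolding upper_def
      by (intro arg_cong[where f = H1_norm] ext)
         (simp add: if_distrib[of "\<lambda>t. - t"] flip: integral_minus cong: if_cong)
    also have "\<dots> \<le> 2 * L2_norm (\<lambda>x. (-1) * k x)"
      using k by (intro H1_norm_upper_le L2_cmult)
    also have "\<dots> < \<epsilon>"
      using k_less unfolding L2_norm_cmult by simp
    finally show ?thesis using \<phi>(1) by blast
  qed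
  with v show "v \<in> H1_0" by (simp add: H1_0_def)
qed

section \<open>The inner product\<close>

lemma upper_const:
  assumes "x \<in> {0..1}"
  shows "upper (\<lambda>_. 1) x = of_real (1 - x)"
proof -
  have meas: "measure unit_interval_measure {x<..<1} = 1 - x"
    using assms by (subst measure_restrict_space) auto
  have "upper (\<lambda>_. 1) x = (LINT y|unit_interval_measure. complex_of_real (indicator {x<..<1} y))"
    unfolding upper_def by (intro Bochner_Integration.integral_cong) (auto simp: indicator_def)
  also have "\<dots> = of_real (LINT y|unit_interval_measure. indicator {x<..<1} y)"
    by (rule integral_complex_of_real)
  also have "(LINT y|unit_interval_measure. indicator {x<..<1} y) = 1 - x"
  proof -
    have "{x<..<1} \<inter> {0<..<1} = {x<..<1}"
      using assms by auto
    then show ?thesis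
      using meas by (simp only: Bochner_Integration.integral_indicator space_unit)
  qed
  finally show ?thesis .
qed

text \<open>By adjointness the mean of \<open>lower h\<close> is the pairing of \<open>h\<close>
  with \<open>upper (\<lambda>_. 1)\<close>; this is the weight \<open>1 - x\<close> in
  \<open>mu1\<close>.\<close>

lemma integral_lower:
  assumes "h \<in> L2"
  shows "(LINT x|unit_interval_measure. lower h x) = mu1 h"
proof -
  have "(LINT x|unit_interval_measure. lower h x) = L2_pairing (upper (\<lambda>_. 1)) h"
    using assms by (simp add: L2_pairing_upper L2_pairing_const)
  also have "\<dots> = mu1 h"
    unfolding L2_pairing_def mu1_def
    using upper_const by (intro Bochner_Integration.integral_cong) auto
  finally show ?thesis .
qed

lemma integral_eq_upper:
  fixes g :: "real \<Rightarrow> complex"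
  assumes "x \<in> {0..1}"
  shows "(LINT y|lebesgue_on {x<..<1}. g y) = upper g x"
proof -
  have "(LINT y|lebesgue_on {x<..<1}. g y) = (LINT y|lebesgue. indicator {x<..<1} y *\<^sub>R g y)"
    by (rule integral_restrict_space) simp
  also have "\<dots> = (LINT y|lebesgue. indicator {0<..<1} y *\<^sub>R (if x < y then g y else 0))"
    using assms by (intro Bochner_Integration.integral_cong) (auto simp: indicator_def)
  also have "\<dots> = upper g x"
    unfolding upper_def by (rule integral_restrict_space[symmetric]) simp
  finally show ?thesis .
qed

lemma J_eq_upper:
  assumes "x \<in> {0..1}"
  shows "J \<phi> x = upper (\<lambda>y. \<phi> y - (LINT z|unit_interval_measure. \<phi> z)) x"
  unfolding J_def using assms by (rule integral_eq_upper)

text \<open>Subtracting the mean before integrating makes \<open>J \<phi>\<close> vanish at 0 as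
  well as at 1, and so places it in \<open>H1_0\<close>.\<close>

lemma
  assumes "\<phi> \<in> L2"
  defines "m \<equiv> (LINT z|unit_interval_measure. \<phi> z)"
  shows J_H1: "J \<phi> \<in> H1" and J_0: "J \<phi> 0 = 0" and J_1: "J \<phi> 1 = 0"
    and has_weak_derivative_J: "has_weak_derivative (J \<phi>) (\<lambda>x. - (\<phi> x - m))"
proof -
  have L2: "(\<lambda>x. \<phi> x - m) \<in> L2"
    using assms(1) by auto
  have J: "upper (\<lambda>x. \<phi> x - m) x = J \<phi> x" if "x \<in> {0..1}" for x
    using J_eq_upper[OF that, of \<phi>] by (simp add: m_def)
  show "J \<phi> \<in> H1"
    using H1_upper[OF L2] J by (rule H1_cong)
  have "(LINT x|unit_interval_measure. \<phi> x - m) = 0"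
    using assms(1) by (simp add: m_def L2_integrable)
  then show "J \<phi> 0 = 0" "J \<phi> 1 = 0"
    using J[of 0] J[of 1] by (simp_all add: upper_0 upper_1)
  have "has_weak_derivative (upper (\<lambda>x. \<phi> x - m)) = has_weak_derivative (J \<phi>)"
    using J by (intro has_weak_derivative_cong) auto
  with has_weak_derivative_upper[OF L2] show "has_weak_derivative (J \<phi>) (\<lambda>x. - (\<phi> x - m))"
    by simp
qed

section \<open>Functionals and the second derivative\<close>

lemma H1_0_add: "v \<in> H1_0 \<Longrightarrow> w \<in> H1_0 \<Longrightarrow> (\<lambda>x. v x + w x) \<in> H1_0"
  by (simp add: H1_0_iff H1_add)

lemma H1_0_cmult: "v \<in> H1_0 \<Longrightarrow> (\<lambda>x. a * v x) \<in> H1_0"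
  by (simp add: H1_0_iff H1_cmult)

lemma test_functions_H1_0: "\<phi> \<in> test_functions \<Longrightarrow> \<phi> \<in> H1_0"
  by (simp add: H1_0_iff test_functions_H1 test_functions_boundary)

lemma H1_0_H1_T: "H1_0 \<subseteq> H1_T"
  by (auto simp: H1_0_iff H1_T_def)

text \<open>Bounded functionals are determined on a dense subspace; this supplies the uniqueness for
  the definite description in \<open>second_derivative\<close>.\<close>

lemma Hm1_eqI:
  assumes "F \<in> Hm1" "G \<in> Hm1" "\<And>\<phi>. \<phi> \<in> test_functions \<Longrightarrow> F \<phi> = G \<phi>"
  shows "F = G"
proof
  fix v
  have split: "K v = K (\<lambda>x. v x - \<phi> x) + K \<phi>"
    if "K \<in> Hm1" "v \<in> H1_0" "\<phi> \<in> test_functions" for K \<phi>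
  proof -
    have w: "(\<lambda>x. v x + (-1) * \<phi> x) \<in> H1_0"
      by (intro that H1_0_add H1_0_cmult test_functions_H1_0[OF that(3)])
    have add: "K (\<lambda>x. f x + g x) = K f + K g" if "f \<in> H1_0" "g \<in> H1_0" for f g
      using \<open>K \<in> Hm1\<close> that by (simp add: Hm1_def dual_def)
    have "K (\<lambda>x. (v x + (-1) * \<phi> x) + \<phi> x) = K (\<lambda>x. v x + (-1) * \<phi> x) + K \<phi>"
      by (rule add[OF w test_functions_H1_0[OF that(3)]])
    then show ?thesis by simp
  qed
  obtain A where A: "\<And>w. w \<in> H1_0 \<Longrightarrow> cmod (F w) \<le> A * H1_norm w"
    using assms(1) unfolding Hm1_def dual_def by blast
  obtain B where B: "\<And>w. w \<in> H1_0 \<Longrightarrow> cmod (G w) \<le> B * H1_norm w"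
    using assms(2) unfolding Hm1_def dual_def by blast
  show "F v = G v"
  proof (cases "v \<in> H1_0")
    case True
    \<comment> \<open>The bounds \<open>A\<close> and \<open>B\<close> may be zero or negative;
      absolute values and the summand 1 make \<open>C\<close> a positive divisor.\<close>
    define C where "C = \<bar>A\<bar> + \<bar>B\<bar> + 1"
    have C: "C > 0"
      by (simp add: C_def add_nonneg_pos)
    have "cmod (F v - G v) \<le> 0 + e" if "e > 0" for e
    proof -
      have "e / C > 0"
        using that C by simp
      then obtain \<phi> where \<phi>: "\<phi> \<in> test_functions" "H1_norm (\<lambda>x. v x - \<phi> x) < e / C"
        using True unfolding H1_0_def by blast
      let ?w = "\<lambda>x. v x - \<phi> x"
      have w: "?w \<in> H1_0"
        using H1_0_add[OF True H1_0_cmult[OF test_functions_H1_0[OF \<phi>(1)], of "-1"]] by simp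
      have "F v - G v = F ?w - G ?w"
        using split[OF assms(1) True \<phi>(1)] split[OF assms(2) True \<phi>(1)] assms(3)[OF \<phi>(1)] by simp
      then have "cmod (F v - G v) \<le> A * H1_norm ?w + B * H1_norm ?w"
        using norm_triangle_ineq4[of "F ?w" "G ?w"] A[OF w] B[OF w] by simp
      also have "\<dots> \<le> C * H1_norm ?w"
        unfolding distrib_right[symmetric] by (intro mult_right_mono H1_norm_nonneg) (simp add: C_def)
      also have "\<dots> \<le> e"
        using \<phi>(2) C by (simp add: field_simps)
      finally show ?thesis by simp
    qed
    then have "cmod (F v - G v) \<le> 0"
      by (rule field_le_epsilon)
    then show ?thesis by simp
  next
    case False
    then show ?thesis
      using assms(1,2) by (simp add: Hm1_def dual_def)
  qed
qed

text \<open>The derivative of \<open>g\<close> as a functional, stated for a general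
  \<open>V\<close> so as to serve both \<open>H1_0\<close> and \<open>H1_T\<close>.\<close>

lemma dual_weak_derivative_pairing:
  assumes "V \<subseteq> H1" "\<And>v w. v \<in> V \<Longrightarrow> w \<in> V \<Longrightarrow> (\<lambda>x. v x + w x) \<in> V"
    and "\<And>a v. v \<in> V \<Longrightarrow> (\<lambda>x. a * v x) \<in> V" and g: "g \<in> L2"
  shows "(\<lambda>v. if v \<in> V then - L2_pairing g (weak_derivative v) else 0) \<in> dual V"
proof -
  have "cmod (- L2_pairing g (weak_derivative v)) \<le> L2_norm g * H1_norm v" if "v \<in> V" for v
  proof -
    have "cmod (L2_pairing g (weak_derivative v)) \<le> L2_norm g * L2_norm (weak_derivative v)"
      using that assms(1) g by (intro L2_Cauchy_Schwarz weak_derivative_L2) auto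
    also have "\<dots> \<le> L2_norm g * H1_norm v"
      by (intro mult_left_mono L2_norm_weak_derivative_le_H1_norm) simp
    finally show ?thesis by simp
  qed
  then have "\<exists>C. \<forall>v\<in>V. cmod (- L2_pairing g (weak_derivative v)) \<le> C * H1_norm v"
    by blast
  then show ?thesis
    using assms unfolding dual_def
    by (auto simp: L2_pairing_weak_derivative_add L2_pairing_weak_derivative_cmult subset_iff)
qed

text \<open>Integrating by parts once instead of twice gives a formula bounded in the
  \<open>H1\<close> norm; on test functions it agrees with the distribution because
  \<open>D \<phi>\<close> is again a test function.\<close>

lemma
  assumes "u \<in> H1"
  shows second_derivative_Hm1: "second_derivative u \<in> Hm1"
    and second_derivative_eq: "v \<in> H1_0 \<Longrightarrow>
      second_derivative u v = - L2_pairing (weak_derivative u) (weak_derivative v)"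
proof -
  define \<psi> where "\<psi> v = (if v \<in> H1_0 then - L2_pairing (weak_derivative u) (weak_derivative v) else 0)" for v
  have Hm1: "\<psi> \<in> Hm1"
    unfolding Hm1_def \<psi>_def[abs_def]
    by (intro dual_weak_derivative_pairing H1_0_add H1_0_cmult weak_derivative_L2 assms) (auto simp: H1_0_iff)
  have test: "\<psi> \<phi> = L2_pairing u (D (D \<phi>))" if "\<phi> \<in> test_functions" for \<phi>
  proof -
    have "L2_pairing (weak_derivative u) (weak_derivative \<phi>) = L2_pairing (weak_derivative u) (D \<phi>)"
      by (intro L2_pairing_weak_derivative test_functions_H1 test_functions_L2[OF test_functions_D]
          has_weak_derivative_test_function weak_derivative_L2 assms that)
    also have "\<dots> = - L2_pairing u (D (D \<phi>))"
      using has_weak_derivative_weak_derivative[OF assms] test_functions_D[OF that]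
      by (simp add: has_weak_derivative_def)
    finally show ?thesis
      using that by (simp add: \<psi>_def test_functions_H1_0)
  qed
  have "second_derivative u = \<psi>"
    unfolding second_derivative_def
    by (rule the_equality) (use Hm1 test in \<open>auto intro: Hm1_eqI\<close>)
  then show "second_derivative u \<in> Hm1" "v \<in> H1_0 \<Longrightarrow>
      second_derivative u v = - L2_pairing (weak_derivative u) (weak_derivative v)"
    using Hm1 by (auto simp: \<psi>_def)
qed

lemma H1_T_const: "(\<lambda>_. a) \<in> H1_T"
  by (simp add: H1_T_def H1_const)

text \<open>The same formula on all of \<open>H1_T\<close> annihilates constants, hence is an
  element of \<open>H\<close> restricting to \<open>second_derivative u\<close>. So
  \<open>inv_into\<close> returns a preimage in \<open>H\<close>, and both claims can be read
  off.\<close>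

lemma
  assumes "u \<in> H1"
  shows mu0_Id_m_inv_second_derivative: "mu0 (Id_m_inv (second_derivative u)) = 0"
    and Id_m_inv_second_derivative: "v \<in> H1_0 \<Longrightarrow> Id_m_inv (second_derivative u) v
      = - L2_pairing (weak_derivative u) (weak_derivative v)"
proof -
  define w where "w v = (if v \<in> H1_T then - L2_pairing (weak_derivative u) (weak_derivative v) else 0)" for v
  have "w \<in> Hm1_T"
    unfolding Hm1_T_def w_def[abs_def]
    by (intro dual_weak_derivative_pairing weak_derivative_L2 assms)
       (auto simp: H1_T_def H1_add H1_cmult)
  moreover have "L2_pairing (weak_derivative u) (weak_derivative (\<lambda>_. 1))
      = L2_pairing (weak_derivative u) (\<lambda>_. 0)"
    by (intro L2_pairing_weak_derivative H1_const L2_const has_weak_derivative_const weak_derivative_L2 assms)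
  then have "mu0 w = 0"
    by (simp add: mu0_def w_def H1_T_const L2_pairing_def)
  ultimately have "w \<in> H"
    by (simp add: H_def)
  moreover have "Id_m w = second_derivative u"
    using second_derivative_Hm1[OF assms] second_derivative_eq[OF assms] H1_0_H1_T
    by (auto simp: Id_m_def w_def fun_eq_iff Hm1_def dual_def)
  ultimately have im: "second_derivative u \<in> Id_m ` H"
    by (metis imageI)
  have "Id_m_inv (second_derivative u) \<in> H"
    unfolding Id_m_inv_def using im by (rule inv_into_into)
  then show "mu0 (Id_m_inv (second_derivative u)) = 0"
    by (simp add: H_def)
  assume v: "v \<in> H1_0"
  have "Id_m (Id_m_inv (second_derivative u)) = second_derivative u"
    unfolding Id_m_inv_def using im by (rule f_inv_into_f)
  then have "Id_m (Id_m_inv (second_derivative u)) v = second_derivative u v"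
    by simp
  with v second_derivative_eq[OF assms v]
  show "Id_m_inv (second_derivative u) v = - L2_pairing (weak_derivative u) (weak_derivative v)"
    by (simp add: Id_m_def)
qed

text \<open>A candidate satisfying the defining relation proves that the choice in \<open>P\<close>
  succeeds; testing the difference against test functions then identifies the choice up to null
  sets.\<close>

lemma P_eqI:
  assumes "f \<in> L2" "\<And>\<phi>. \<phi> \<in> L2 \<Longrightarrow> L2_pairing f \<phi> = F (J \<phi>)"
  shows "P F \<in> L2" "AE x in unit_interval_measure. P F x = f x"
proof -
  have "\<exists>f. f \<in> L2 \<and> (\<forall>\<phi>\<in>L2. L2_pairing f \<phi> = F (J \<phi>))"
    using assms by blast
  from someI_ex[OF this] have P: "P F \<in> L2" "\<And>\<phi>. \<phi> \<in> L2 \<Longrightarrow> L2_pairing (P F) \<phi> = F (J \<phi>)"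
    by (auto simp: P_def)
  then show "P F \<in> L2" by simp
  have "AE x in unit_interval_measure. P F x - f x = 0"
    using P assms
    by (intro L2_pairing_test_functions_eq_0) (auto simp: L2_pairing_diff_left test_functions_L2)
  then show "AE x in unit_interval_measure. P F x = f x" by simp
qed

lemma L2_inner_eq_pairing: "L2_inner f g = L2_pairing f (\<lambda>x. cnj (g x))"
  by (simp add: L2_inner_def L2_pairing_def)

lemma L2_pairing_1_right: "L2_pairing f (\<lambda>_. a) = a * (LINT x|unit_interval_measure. f x)"
  by (simp add: L2_pairing_commute[of f] L2_pairing_const)

lemma lower_cnj: "lower (\<lambda>x. cnj (h x)) y = cnj (lower h y)"
  unfolding lower_def
  by (simp add: if_distrib[of cnj] flip: Bochner_Integration.integral_cnj cong: if_cong)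

theorem lemma2p11:
  fixes u h :: "real \<Rightarrow> complex" and c :: complex
  assumes "u \<in> H1" and "h \<in> L2"
  shows "Hm1_T_inner (\<lambda>v. Id_m_inv (second_derivative u) v + c * delta1 v) (L2_to_Hm1_T h)
       = C2_inner (vector [c + u 1, u 0 - u 1]) (vector [mu0 (L2_to_Hm1_T h), mu1 h]) - L2_inner u h"
proof -
  define F where "F v = Id_m_inv (second_derivative u) v + c * delta1 v" for v
  define G where "G = L2_to_Hm1_T h"
  define g where "g = weak_derivative u"
  define a where "a = u 1 - u 0"
  define b where "b = mu1 h"
  have g: "g \<in> L2" "(LINT x|unit_interval_measure. g x) = a"
    using assms(1) by (simp_all add: g_def a_def weak_derivative_L2 integral_weak_derivative)
  have J_H1_0: "J \<phi> \<in> H1_0" if "\<phi> \<in> L2" for \<phi>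
    using that by (simp add: H1_0_iff J_H1 J_0 J_1)
  have PF: "P F \<in> L2" "AE x in unit_interval_measure. P F x = g x - a"
  proof -
    have "L2_pairing (\<lambda>x. g x - a) \<phi> = F (J \<phi>)" if \<phi>: "\<phi> \<in> L2" for \<phi>
    proof -
      define m where "m = (LINT x|unit_interval_measure. \<phi> x)"
      have "F (J \<phi>) = - L2_pairing g (weak_derivative (J \<phi>))"
        using Id_m_inv_second_derivative[OF assms(1) J_H1_0[OF \<phi>]] J_1[OF \<phi>]
        by (simp add: F_def g_def delta1_def)
      also have "L2_pairing g (weak_derivative (J \<phi>)) = L2_pairing g (\<lambda>x. - (\<phi> x - m))"
        using \<phi> g unfolding m_def
        by (intro L2_pairing_weak_derivative J_H1 has_weak_derivative_J L2_uminus L2_diff L2_const)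
      also have "\<dots> = L2_pairing g (\<lambda>x. m - \<phi> x)"
        by simp
      \<comment> \<open>The mean of \<open>g\<close> is \<open>a\<close>, so the constant
        \<open>m\<close> moved off \<open>\<phi>\<close> reappears as the constant \<open>a\<close>
        subtracted from \<open>g\<close>.\<close>
      also have "\<dots> = - L2_pairing (\<lambda>x. g x - a) \<phi>"
        using g \<phi> by (simp add: L2_pairing_diff_left L2_pairing_diff_right L2_pairing_const
            L2_pairing_1_right m_def)
      finally show ?thesis by simp
    qed
    then show "P F \<in> L2" "AE x in unit_interval_measure. P F x = g x - a"
      using P_eqI[of "\<lambda>x. g x - a" F] L2_diff[OF g(1) L2_const] by blast+
  qed
  have PG: "P G \<in> L2" "AE x in unit_interval_measure. P G x = lower h x - b"
  proof -
    have "L2_pairing (\<lambda>x. lower h x - b) \<phi> = G (J \<phi>)" if \<phi>: "\<phi> \<in> L2" for \<phi>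
    proof -
      define m where "m = (LINT x|unit_interval_measure. \<phi> x)"
      have L2: "(\<lambda>x. \<phi> x - m) \<in> L2"
        using \<phi> by auto
      have "G (J \<phi>) = L2_pairing (J \<phi>) h"
        using J_H1_0[OF \<phi>] H1_0_H1_T by (auto simp: G_def L2_to_Hm1_T_def L2_pairing_commute)
      also have "\<dots> = L2_pairing (upper (\<lambda>x. \<phi> x - m)) h"
        using J_eq_upper by (intro L2_pairing_cong) (auto simp: m_def)
      also have "\<dots> = L2_pairing (\<lambda>x. \<phi> x - m) (lower h)"
        by (rule L2_pairing_upper[OF assms(2) L2])
      \<comment> \<open>The same exchange, now with \<open>b\<close> as the mean of
        \<open>lower h\<close>.\<close>
      also have "\<dots> = L2_pairing (\<lambda>x. lower h x - b) \<phi>"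
        using \<phi> assms(2) lower_L2[OF assms(2)] integral_lower[OF assms(2)]
        by (simp add: L2_pairing_diff_left L2_pairing_const L2_pairing_commute[of \<phi>] m_def b_def)
      finally show ?thesis by simp
    qed
    then show "P G \<in> L2" "AE x in unit_interval_measure. P G x = lower h x - b"
      using P_eqI[of "\<lambda>x. lower h x - b" G] L2_diff[OF lower_L2[OF assms(2)] L2_const] by blast+
  qed
  \<comment> \<open>Conjugation commutes with \<open>lower\<close>; putting it on \<open>h\<close>
    lets the bilinear identities apply.\<close>
  let ?k = "\<lambda>x. cnj (h x)"
  have k: "?k \<in> L2" "lower ?k \<in> L2"
    using assms(2) by (auto intro: lower_L2)
  have "L2_inner (P F) (P G) = L2_pairing (\<lambda>x. g x - a) (\<lambda>x. lower ?k x - cnj b)"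
  proof -
    note [measurable] = L2_measurable[OF PF(1)] L2_measurable[OF PG(1)] L2_measurable[OF g(1)]
      L2_measurable[OF lower_L2[OF assms(2)]] L2_measurable[OF L2_cnj[OF PG(1)]] L2_measurable[OF k(2)]
    show ?thesis
      unfolding L2_inner_eq_pairing L2_pairing_def
    proof (rule integral_cong_AE)
      show "AE x in unit_interval_measure. P F x * cnj (P G x) = (g x - a) * (lower ?k x - cnj b)"
        using PF(2) PG(2) by eventually_elim (simp add: lower_cnj)
    qed measurable
  qed
  \<comment> \<open>Once the mean of \<open>lower ?k\<close> is known to be \<open>cnj b\<close>,
    two of the three constant terms cancel and \<open>- a * cnj b\<close> remains.\<close>
  also have "\<dots> = L2_pairing g (lower ?k) - cnj b * a - a * (LINT x|unit_interval_measure. lower ?k x) + a * cnj b"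
    using g k by (simp add: L2_pairing_diff_left L2_pairing_diff_right L2_diff L2_pairing_const
        L2_pairing_1_right L2_integrable algebra_simps)
  also have "(LINT x|unit_interval_measure. lower ?k x) = cnj b"
    using integral_lower[OF assms(2)] by (simp add: lower_cnj b_def)
  also have "L2_pairing g (lower ?k) = L2_pairing (upper g) ?k"
    using L2_pairing_upper[OF k(1) g(1)] by simp
  also have "\<dots> = L2_pairing (\<lambda>x. u 1 - u x) ?k"
  proof (rule L2_pairing_cong)
    show "upper g x = u 1 - u x" if "x \<in> {0<..<1}" for x
      using H1_eq_upper[OF assms(1), of x] that by (simp add: g_def)
  qed simp
  also have "\<dots> = u 1 * cnj (LINT x|unit_interval_measure. h x) - L2_inner u h"
    using assms H1_L2[OF assms(1)] k(1)
    by (simp add: L2_pairing_diff_left L2_pairing_const L2_inner_eq_pairing)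
  finally have inner: "L2_inner (P F) (P G)
      = u 1 * cnj (LINT x|unit_interval_measure. h x) - L2_inner u h - a * cnj b"
    by (simp add: algebra_simps)
  have "mu0 F = c"
    using mu0_Id_m_inv_second_derivative[OF assms(1)] H1_T_const[of 1]
    by (simp add: mu0_def F_def delta1_def)
  moreover have "mu0 G = (LINT x|unit_interval_measure. h x)"
    using H1_T_const[of 1] by (simp add: mu0_def G_def L2_to_Hm1_T_def L2_pairing_1_right)
  moreover have "C2_inner (vector [x, y]) (vector [z, w]) = x * cnj z + y * cnj w" for x y z w
    by (simp add: C2_inner_def sum_2)
  \<comment> \<open>The product of the \<open>mu0\<close> values contributes
    \<open>c * cnj (mu0 G)\<close>, which joins the \<open>u 1\<close> term in the first
    component.\<close>
  ultimately have "Hm1_T_inner F G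
      = C2_inner (vector [c + u 1, u 0 - u 1]) (vector [mu0 G, mu1 h]) - L2_inner u h"
    unfolding Hm1_T_inner_def inner a_def b_def by (simp only: ring_distribs) simp
  then show ?thesis
    by (simp add: F_def[abs_def] G_def)
qed

end
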